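(* Let $\mathsf G_e$ be the expanded virtual game defined in the context, let $V_t^u,V_t^l$ be the value functions of the min-max and max-min dynamic programs, and let $\Pi_1$ be the initial common information belief, $\Pi_1(x_1,p_1^1,p_1^2)=\mathbb P(X_1=x_1,P_1^1=p_1^1,P_1^2=p_1^2\mid C_1)$. Then the upper and lower values of $\mathsf G_e$ are $$S^u(\mathsf G_e)=\mathbb E[V_1^u(\Pi_1)],\qquad S^l(\mathsf G_e)=\mathbb E[V_1^l(\Pi_1)].$$ Further, the strategies $\tilde\chi^{1*}$ and $\tilde\chi^{2*}$ defined in the context are, respectively, a min-max strategy (it attains the infimum in $\inf_{\tilde\chi^1}\sup_{\tilde\chi^2}\mathcal J(\tilde\chi^1,\tilde\chi^2)$) and a max-min strategy (it attains the supremum in $\sup_{\tilde\chi^2}\inf_{\tilde\chi^1}\mathcal J(\tilde\chi^1,\tilde\chi^2)$) in $\mathsf G_e$.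
   Context: **Notation.** $\Delta\mathcal A$ is the probability simplex over a finite set $\mathcal A$. $X_{a:b}=(X_a,\dots,X_b)$, $X^{1:2}=(X^1,X^2)$. **System.** Fix a horizon $T$ and finite sets $\mathcal X_t$ (states), $\mathcal U_t^i$ (actions), $\mathcal Y_t^i$ (observations), $i=1,2$. The state evolves as $X_{t+1}=f_t(X_t,U_t^1,U_t^2,W_t^s)$ and the observations are $Y_t^i=h_t^i(X_t,U_{t-1}^1,U_{t-1}^2,W_t^i)$ (no action arguments at $t=1$). The primitive random variables $X_1,W_t^s,W_t^i$ take finitely many values and are mutually independent. Objects indexed by $T+1$ are defined by the same equations. Player $i$'s information at time $t$ is a collection of variables $I_t^i\subseteq\{Y^{1:2}_{1:t},U^{1:2}_{1:t-1}\}$, decomposed as $I_t^i=C_t\cup P_t^i$, with $C_t$ (common information) known to both players and $P_t^i$ (private information) known only to player $i$; $\mathcal C_t,\mathcal P_t^i$ are the (finite) sets of realizations. Standing assumption: $C_t\subset C_{t+1}$, the increment $Z_{t+1}:=C_{t+1}\setminus C_t$ (values in a finite set $\mathcal Z_{t+1}$) satisfies $Z_{t+1}=\zeta_{t+1}(P_t^{1:2},U_t^{1:2},Y_{t+1}^{1:2})$, and $P_{t+1}^i=\xi_{t+1}^i(P_t^i,U_t^i,Y_{t+1}^i)$, for fixed functions. **Expanded virtual game $\mathsf G_e$.** At time $t$ virtual player $i$ selects a prescription $\Gamma_t^i\in\mathcal B_t^i:=\{\text{maps }\mathcal P_t^i\to\Delta\mathcal U_t^i\}$ as $\Gamma_t^i=\tilde\chi_t^i(C_t,\Gamma_{1:t-1}^{1:2})$;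 then $U_t^i=\kappa(\Gamma_t^i(P_t^i),K_t^i)$, where $K^1_{1:T},K^2_{1:T}$ are i.i.d. uniform on $(0,1]$, independent of each other and of the primitive random variables, and $\kappa(\delta,K)$ has distribution $\delta$ for $K$ uniform on $(0,1]$. $\tilde{\mathcal H}^i$ is the set of all strategies $\tilde\chi^i=(\tilde\chi_1^i,\dots,\tilde\chi_T^i)$. The cost is $\mathcal J(\tilde\chi^1,\tilde\chi^2)=\mathbb E^{(\tilde\chi^1,\tilde\chi^2)}[\sum_{t=1}^Tc_t(X_t,U_t^1,U_t^2)]$ with $c_t:\mathcal X_t\times\mathcal U_t^1\times\mathcal U_t^2\to\mathbb R$; player 1 minimizes, player 2 maximizes. $S^u(\mathsf G_e)=\inf_{\tilde\chi^1\in\tilde{\mathcal H}^1}\sup_{\tilde\chi^2\in\tilde{\mathcal H}^2}\mathcal J(\tilde\chi^1,\tilde\chi^2)$ and $S^l(\mathsf G_e)=\sup_{\tilde\chi^2}\inf_{\tilde\chi^1}\mathcal J(\tilde\chi^1,\tilde\chi^2)$. **Belief update.** Let $\mathcal S_t=\Delta(\mathcal X_t\times\mathcal P_t^1\times\mathcal P_t^2)$. Write $\gamma^i(p;u)$ for the probability of $u$ under $\gamma^i(p)$. For $\pi\in\mathcal S_t,\gamma^i\in\mathcal B_t^i$ put $$P_t^j(\pi,\gamma^{1:2};z,x',p'^{1:2})=\sum_{x,p^{1:2},u^{1:2}}\pi(x,p^{1:2})\gamma^1(p^1;u^1)\gamma^2(p^2;u^2)\,\mathbb P[X_{t+1}=x',P_{t+1}^{1:2}=p'^{1:2},Z_{t+1}=z\mid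 X_t=x,P_t^{1:2}=p^{1:2},U_t^{1:2}=u^{1:2}],$$ where the last factor is the transition kernel given by the system equations, and $P_t^m(\pi,\gamma^{1:2};z)=\sum_{x',p'^{1:2}}P_t^j(\pi,\gamma^{1:2};z,x',p'^{1:2})$. Let $F_t(\pi,\gamma^{1:2},z)=P_t^j(\pi,\gamma^{1:2};z,\cdot,\cdot)/P_t^m(\pi,\gamma^{1:2};z)$ if $P_t^m(\pi,\gamma^{1:2};z)>0$, and $F_t(\pi,\gamma^{1:2},z)=G_t(\pi,\gamma^{1:2},z)$ otherwise, where $G_t$ is an arbitrary fixed measurable map into $\mathcal S_{t+1}$. **Dynamic programs.** Let $\tilde c_t(\pi,\gamma^1,\gamma^2)=\sum_{x,p^{1:2},u^{1:2}}c_t(x,u^1,u^2)\pi(x,p^1,p^2)\gamma^1(p^1;u^1)\gamma^2(p^2;u^2)$. Min-max program: $V_{T+1}^u\equiv0$ and, for $t\le T$, $\pi_t\in\mathcal S_t$, $$w_t^u(\pi_t,\gamma_t^1,\gamma_t^2)=\tilde c_t(\pi_t,\gamma_t^1,\gamma_t^2)+\mathbb E[V_{t+1}^u(F_t(\pi_t,\gamma_t^{1:2},Z_{t+1}))\mid\pi_t,\gamma_t^{1:2}],\quad V_t^u(\pi_t)=\inf_{\gamma_t^1\in\mathcal B_t^1}\sup_{\gamma_t^2\in\mathcal B_t^2}w_t^u(\pi_t,\gamma_t^1,\gamma_t^2),$$ where the conditional expectation is over $Z_{t+1}\sim P_t^m(\pi_t,\gamma_t^{1:2};\cdot)$. Max-min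 program: $V_{T+1}^l\equiv0$, $w_t^l$ is defined by the same formula with $V_{t+1}^l$ in place of $V_{t+1}^u$, and $V_t^l(\pi_t)=\sup_{\gamma_t^2}\inf_{\gamma_t^1}w_t^l(\pi_t,\gamma_t^1,\gamma_t^2)$. Let $\Xi_t^1:\mathcal S_t\to\mathcal B_t^1$ and $\Xi_t^2:\mathcal S_t\to\mathcal B_t^2$ be measurable maps with $V_t^u(\pi_t)=\max_{\gamma_t^2}w_t^u(\pi_t,\Xi_t^1(\pi_t),\gamma_t^2)$ and $V_t^l(\pi_t)=\min_{\gamma_t^1}w_t^l(\pi_t,\gamma_t^1,\Xi_t^2(\pi_t))$ for all $\pi_t$ (such maps exist). **Strategies $\tilde\chi^{1*},\tilde\chi^{2*}$.** For each $c_t$ and $\gamma_{1:t-1}^{1:2}$, $\tilde\chi_t^{1*}(c_t,\gamma_{1:t-1}^{1:2})=\Xi_t^1(\pi_t)$ and $\tilde\chi_t^{2*}(c_t,\gamma_{1:t-1}^{1:2})=\Xi_t^2(\pi_t)$, where $\pi_1(x_1,p_1^1,p_1^2)=\mathbb P[X_1=x_1,P_1^1=p_1^1,P_1^2=p_1^2\mid C_1=c_1]$ and $\pi_{\tau+1}=F_\tau(\pi_\tau,\gamma_\tau^1,\gamma_\tau^2,z_{\tau+1})$ for $1\le\tau<t$. *)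

theory Defs
  imports "HOL-Probability.Probability"
begin

section \<open>The game data\<close>

text \<open>
  The virtual players are \<open>P1\<close> (minimizer) and \<open>P2\<close> (maximizer). The names \<open>YVar i t\<close> and
  \<open>UVar i t\<close> stand for the variables $Y_t^i$ and $U_t^i$. Information ``collections of variables''
  are sets of such names, and a realization of a collection \<open>A\<close> is a function in
  \<open>realz G A\<close> assigning to each name in \<open>A\<close> a value (\<open>Inl\<close> for observations, \<open>Inr\<close> for
  actions) and \<open>undefined\<close> elsewhere.
\<close>

datatype player = P1 | P2

datatype var = YVar player nat | UVar player nat

type_synonym ('y, 'u) realiz = "var \<Rightarrow> 'y + 'u"
type_synonym ('y, 'u) prescr = "('y, 'u) realiz \<Rightarrow> 'u \<Rightarrow> real"
type_synonym ('x, 'y, 'u) belief = "'x \<times> ('y, 'u) realiz \<times> ('y, 'u) realiz \<Rightarrow> real"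
type_synonym ('y, 'u) prhist = "nat \<Rightarrow> ('y, 'u) prescr \<times> ('y, 'u) prescr"
type_synonym ('y, 'u) strategy = "nat \<Rightarrow> ('y, 'u) realiz \<Rightarrow> ('y, 'u) prhist \<Rightarrow> ('y, 'u) prescr"

text \<open>
  \<open>dyn\<close>, \<open>obs_init\<close>, \<open>obs_map\<close>, \<open>incr\<close> and \<open>upd\<close> are the maps $f_t$, $h_1^i$, $h_t^i$
  (for $t \ge 2$), $\zeta_t$ and $\xi_t^i$. All random variables live on the probability space
  \<open>space_of\<close>: \<open>x_init\<close> is $X_1$, \<open>snoise t\<close> is $W_t^s$, \<open>onoise i t\<close> is $W_t^i$ and
  \<open>rnd i t\<close> is $K_t^i$. \<open>null_update t\<close> is the arbitrary map $G_t$, and \<open>null_prior\<close> fixes, equally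
  arbitrarily, the conditional law given $C_1 = c_1$ when that event has probability zero.
\<close>

record ('m, 'x, 'u, 'y, 'w) game =
  horizon :: nat
  states :: "nat \<Rightarrow> 'x set"
  acts :: "player \<Rightarrow> nat \<Rightarrow> 'u set"
  obs :: "player \<Rightarrow> nat \<Rightarrow> 'y set"
  dyn :: "nat \<Rightarrow> 'x \<Rightarrow> 'u \<Rightarrow> 'u \<Rightarrow> 'w \<Rightarrow> 'x"
  obs_init :: "player \<Rightarrow> 'x \<Rightarrow> 'w \<Rightarrow> 'y"
  obs_map :: "player \<Rightarrow> nat \<Rightarrow> 'x \<Rightarrow> 'u \<Rightarrow> 'u \<Rightarrow> 'w \<Rightarrow> 'y"
  cost :: "nat \<Rightarrow> 'x \<Rightarrow> 'u \<Rightarrow> 'u \<Rightarrow> real"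
  info :: "player \<Rightarrow> nat \<Rightarrow> var set"
  incr :: "nat \<Rightarrow> ('y, 'u) realiz \<Rightarrow> ('y, 'u) realiz \<Rightarrow> 'u \<Rightarrow> 'u \<Rightarrow> 'y \<Rightarrow> 'y \<Rightarrow> ('y, 'u) realiz"
  upd :: "player \<Rightarrow> nat \<Rightarrow> ('y, 'u) realiz \<Rightarrow> 'u \<Rightarrow> 'y \<Rightarrow> ('y, 'u) realiz"
  space_of :: "'m measure"
  x_init :: "'m \<Rightarrow> 'x"
  snoise :: "nat \<Rightarrow> 'm \<Rightarrow> 'w"
  onoise :: "player \<Rightarrow> nat \<Rightarrow> 'm \<Rightarrow> 'w"
  rnd :: "player \<Rightarrow> nat \<Rightarrow> 'm \<Rightarrow> real"
  kappa :: "('u \<Rightarrow> real) \<Rightarrow> real \<Rightarrow> 'u"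
  null_prior :: "('y, 'u) realiz \<Rightarrow> ('x, 'y, 'u) belief"
  null_update :: "nat \<Rightarrow> ('x, 'y, 'u) belief \<Rightarrow> ('y, 'u) prescr \<Rightarrow> ('y, 'u) prescr
                    \<Rightarrow> ('y, 'u) realiz \<Rightarrow> ('x, 'y, 'u) belief"

text \<open>Since $C_t$ is what both players know and $P_t^i$ is what only player \<open>i\<close> knows, the
  decomposition $I_t^i = C_t \cup P_t^i$ is determined by the sets $I_t^1, I_t^2$.\<close>

definition com :: "('m,'x,'u,'y,'w) game \<Rightarrow> nat \<Rightarrow> var set" where
  "com G t = info G P1 t \<inter> info G P2 t"

definition priv :: "('m,'x,'u,'y,'w) game \<Rightarrow> player \<Rightarrow> nat \<Rightarrow> var set" where
  "priv G i t = info G i t - com G t"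

definition inc :: "('m,'x,'u,'y,'w) game \<Rightarrow> nat \<Rightarrow> var set" where
  "inc G t = com G t - com G (t - 1)"

primrec var_range :: "('m,'x,'u,'y,'w) game \<Rightarrow> var \<Rightarrow> ('y + 'u) set" where
  "var_range G (YVar i t) = Inl ` obs G i t"
| "var_range G (UVar i t) = Inr ` acts G i t"

definition realz :: "('m,'x,'u,'y,'w) game \<Rightarrow> var set \<Rightarrow> ('y, 'u) realiz set" where
  "realz G A = Pi\<^sub>E A (var_range G)"


section \<open>Simplices and prescriptions\<close>

text \<open>A distribution on the finite set \<open>A\<close> is represented by its mass function, which vanishes
  outside \<open>A\<close>.\<close>

definition prob_simplex :: "'a set \<Rightarrow> ('a \<Rightarrow> real) set" where
  "prob_simplex A = {\<delta>. (\<forall>a\<in>A. 0 \<le> \<delta> a) \<and> (\<forall>a. a \<notin> A \<longrightarrow> \<delta> a = 0) \<and> (\<Sum>a\<in>A. \<delta> a) = 1}"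

definition prescrs :: "('m,'x,'u,'y,'w) game \<Rightarrow> player \<Rightarrow> nat \<Rightarrow> ('y, 'u) prescr set" where
  "prescrs G i t = realz G (priv G i t) \<rightarrow>\<^sub>E prob_simplex (acts G i t)"

definition hidden :: "('m,'x,'u,'y,'w) game \<Rightarrow> nat \<Rightarrow> ('x \<times> ('y, 'u) realiz \<times> ('y, 'u) realiz) set" where
  "hidden G t = states G t \<times> realz G (priv G P1 t) \<times> realz G (priv G P2 t)"

definition beliefs :: "('m,'x,'u,'y,'w) game \<Rightarrow> nat \<Rightarrow> ('x, 'y, 'u) belief set" where
  "beliefs G t = prob_simplex (hidden G t)"

text \<open>\<open>borel\<close> on a function type is the Borel algebra of the product topology. Elements of
  \<open>beliefs G t\<close> and \<open>prescrs G i t\<close> are constant outside finite index sets, so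
  restricting \<open>borel\<close> to these sets gives their usual Euclidean Borel algebras.\<close>

definition belief_space :: "('m,'x,'u,'y,'w) game \<Rightarrow> nat \<Rightarrow> ('x, 'y, 'u) belief measure" where
  "belief_space G t = restrict_space borel (beliefs G t)"

definition prescr_space :: "('m,'x,'u,'y,'w) game \<Rightarrow> player \<Rightarrow> nat \<Rightarrow> ('y, 'u) prescr measure" where
  "prescr_space G i t = restrict_space borel (prescrs G i t)"


section \<open>The system under given action sequences\<close>

text \<open>In \<open>state_at\<close> (and in \<open>cib\<close> below) time starts at 1; the clause for 0 is a dummy.\<close>

fun state_at :: "('m,'x,'u,'y,'w) game \<Rightarrow> 'm \<Rightarrow> (player \<Rightarrow> nat \<Rightarrow> 'u) \<Rightarrow> nat \<Rightarrow> 'x" where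
  "state_at G \<omega> u 0 = x_init G \<omega>"
| "state_at G \<omega> u (Suc 0) = x_init G \<omega>"
| "state_at G \<omega> u (Suc (Suc n)) =
     dyn G (Suc n) (state_at G \<omega> u (Suc n)) (u P1 (Suc n)) (u P2 (Suc n)) (snoise G (Suc n) \<omega>)"

definition obs_at :: "('m,'x,'u,'y,'w) game \<Rightarrow> 'm \<Rightarrow> (player \<Rightarrow> nat \<Rightarrow> 'u) \<Rightarrow> player \<Rightarrow> nat \<Rightarrow> 'y" where
  "obs_at G \<omega> u i t =
     (if t = 1 then obs_init G i (state_at G \<omega> u 1) (onoise G i 1 \<omega>)
      else obs_map G i t (state_at G \<omega> u t) (u P1 (t - 1)) (u P2 (t - 1)) (onoise G i t \<omega>))"

primrec value_at :: "('m,'x,'u,'y,'w) game \<Rightarrow> 'm \<Rightarrow> (player \<Rightarrow> nat \<Rightarrow> 'u) \<Rightarrow> var \<Rightarrow> 'y + 'u" where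
  "value_at G \<omega> u (YVar i t) = Inl (obs_at G \<omega> u i t)"
| "value_at G \<omega> u (UVar i t) = Inr (u i t)"

definition realized :: "('m,'x,'u,'y,'w) game \<Rightarrow> 'm \<Rightarrow> (player \<Rightarrow> nat \<Rightarrow> 'u) \<Rightarrow> var set \<Rightarrow> ('y, 'u) realiz" where
  "realized G \<omega> u A = restrict (value_at G \<omega> u) A"


section \<open>Standing assumptions\<close>

datatype source = Init | SNoise nat | ONoise player nat | Rand player nat

definition sources :: "('m,'x,'u,'y,'w) game \<Rightarrow> source set" where
  "sources G = {Init} \<union> SNoise ` {1..horizon G} \<union> (\<Union>i. ONoise i ` {1..horizon G + 1})
                \<union> (\<Union>i. Rand i ` {1..horizon G})"

primrec source_events :: "('m,'x,'u,'y,'w) game \<Rightarrow> source \<Rightarrow> 'm set set" where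
  "source_events G Init = sets (vimage_algebra (space (space_of G)) (x_init G) (count_space UNIV))"
| "source_events G (SNoise t) =
     sets (vimage_algebra (space (space_of G)) (snoise G t) (count_space UNIV))"
| "source_events G (ONoise i t) =
     sets (vimage_algebra (space (space_of G)) (onoise G i t) (count_space UNIV))"
| "source_events G (Rand i t) = sets (vimage_algebra (space (space_of G)) (rnd G i t) borel)"

locale expanded_game =
  fixes G :: "('m,'x,'u,'y,'w) game"
  assumes horizon_pos: "1 \<le> horizon G"
    and finite_states: "\<And>t. t \<in> {1..horizon G + 1} \<Longrightarrow> finite (states G t)"
    and finite_acts: "\<And>i t. t \<in> {1..horizon G} \<Longrightarrow> finite (acts G i t) \<and> acts G i t \<noteq> {}"
    and finite_obs: "\<And>i t. t \<in> {1..horizon G + 1} \<Longrightarrow> finite (obs G i t)"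
    and prob_space_of: "prob_space (space_of G)"
    and x_init_rv: "x_init G \<in> measurable (space_of G) (count_space UNIV)"
    and x_init_states: "\<And>\<omega>. \<omega> \<in> space (space_of G) \<Longrightarrow> x_init G \<omega> \<in> states G 1"
    and snoise_rv: "\<And>t. t \<in> {1..horizon G} \<Longrightarrow> snoise G t \<in> measurable (space_of G) (count_space UNIV)"
    and snoise_finite: "\<And>t. t \<in> {1..horizon G} \<Longrightarrow> finite (snoise G t ` space (space_of G))"
    and onoise_rv: "\<And>i t. t \<in> {1..horizon G + 1} \<Longrightarrow>
          onoise G i t \<in> measurable (space_of G) (count_space UNIV)"
    and onoise_finite: "\<And>i t. t \<in> {1..horizon G + 1} \<Longrightarrow> finite (onoise G i t ` space (space_of G))"
    and rnd_rv: "\<And>i t. t \<in> {1..horizon G} \<Longrightarrow>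
          rnd G i t \<in> measurable (space_of G) (restrict_space borel {0<..1})"
    and rnd_uniform: "\<And>i t. t \<in> {1..horizon G} \<Longrightarrow>
          distr (space_of G) borel (rnd G i t) = uniform_measure lborel {0<..1}"
    and independent: "prob_space.indep_sets (space_of G) (source_events G) (sources G)"
    and dyn_states: "\<And>t x u1 u2 \<omega>. \<lbrakk>t \<in> {1..horizon G}; x \<in> states G t; u1 \<in> acts G P1 t;
          u2 \<in> acts G P2 t; \<omega> \<in> space (space_of G)\<rbrakk>
          \<Longrightarrow> dyn G t x u1 u2 (snoise G t \<omega>) \<in> states G (t + 1)"
    and obs_init_obs: "\<And>i x \<omega>. \<lbrakk>x \<in> states G 1; \<omega> \<in> space (space_of G)\<rbrakk>
          \<Longrightarrow> obs_init G i x (onoise G i 1 \<omega>) \<in> obs G i 1"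
    and obs_map_obs: "\<And>i t x u1 u2 \<omega>. \<lbrakk>t \<in> {1..horizon G}; x \<in> states G (t + 1); u1 \<in> acts G P1 t;
          u2 \<in> acts G P2 t; \<omega> \<in> space (space_of G)\<rbrakk>
          \<Longrightarrow> obs_map G i (t + 1) x u1 u2 (onoise G i (t + 1) \<omega>) \<in> obs G i (t + 1)"
    and info_available: "\<And>i t. t \<in> {1..horizon G + 1} \<Longrightarrow>
          info G i t \<subseteq> {YVar j s |j s. s \<in> {1..t}} \<union> {UVar j s |j s. s \<in> {1..<t}}"
    and com_mono: "\<And>t. t \<in> {1..horizon G} \<Longrightarrow> com G t \<subseteq> com G (t + 1)"
    and incr_typed: "\<And>t p1 p2 u1 u2 y1 y2. \<lbrakk>t \<in> {1..horizon G};
          p1 \<in> realz G (priv G P1 t); p2 \<in> realz G (priv G P2 t); u1 \<in> acts G P1 t; u2 \<in> acts G P2 t;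
          y1 \<in> obs G P1 (t + 1); y2 \<in> obs G P2 (t + 1)\<rbrakk>
          \<Longrightarrow> incr G (t + 1) p1 p2 u1 u2 y1 y2 \<in> realz G (inc G (t + 1))"
    and upd_typed: "\<And>i t p u y. \<lbrakk>t \<in> {1..horizon G}; p \<in> realz G (priv G i t); u \<in> acts G i t;
          y \<in> obs G i (t + 1)\<rbrakk> \<Longrightarrow> upd G i (t + 1) p u y \<in> realz G (priv G i (t + 1))"
    and incr_eq: "\<And>t \<omega> u. \<lbrakk>t \<in> {1..horizon G}; \<omega> \<in> space (space_of G);
          \<And>i s. s \<in> {1..horizon G} \<Longrightarrow> u i s \<in> acts G i s\<rbrakk>
          \<Longrightarrow> realized G \<omega> u (inc G (t + 1)) =
              incr G (t + 1) (realized G \<omega> u (priv G P1 t)) (realized G \<omega> u (priv G P2 t))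
                (u P1 t) (u P2 t) (obs_at G \<omega> u P1 (t + 1)) (obs_at G \<omega> u P2 (t + 1))"
    and upd_eq: "\<And>i t \<omega> u. \<lbrakk>t \<in> {1..horizon G}; \<omega> \<in> space (space_of G);
          \<And>i s. s \<in> {1..horizon G} \<Longrightarrow> u i s \<in> acts G i s\<rbrakk>
          \<Longrightarrow> realized G \<omega> u (priv G i (t + 1)) =
              upd G i (t + 1) (realized G \<omega> u (priv G i t)) (u i t) (obs_at G \<omega> u i (t + 1))"
    and kappa_measurable: "\<And>i t \<delta>. \<lbrakk>t \<in> {1..horizon G}; \<delta> \<in> prob_simplex (acts G i t)\<rbrakk>
          \<Longrightarrow> kappa G \<delta> \<in> measurable (restrict_space borel {0<..1}) (count_space (acts G i t))"
    and kappa_law: "\<And>i t \<delta> a. \<lbrakk>t \<in> {1..horizon G}; \<delta> \<in> prob_simplex (acts G i t); a \<in> acts G i t\<rbrakk>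
          \<Longrightarrow> measure (uniform_measure lborel {0<..1}) {k \<in> {0<..1}. kappa G \<delta> k = a} = \<delta> a"
    and null_prior_beliefs: "\<And>c. c \<in> realz G (com G 1) \<Longrightarrow> null_prior G c \<in> beliefs G 1"
    and null_update_measurable: "\<And>t. t \<in> {1..horizon G} \<Longrightarrow>
          (\<lambda>(\<pi>, \<gamma>1, \<gamma>2, z). null_update G t \<pi> \<gamma>1 \<gamma>2 z) \<in>
            measurable (belief_space G t \<Otimes>\<^sub>M prescr_space G P1 t \<Otimes>\<^sub>M prescr_space G P2 t
                          \<Otimes>\<^sub>M count_space (realz G (inc G (t + 1))))
                       (belief_space G (t + 1))"


section \<open>Strategies, cost and values of the expanded virtual game\<close>

definition strategies :: "('m,'x,'u,'y,'w) game \<Rightarrow> player \<Rightarrow> ('y, 'u) strategy set" where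
  "strategies G i = {\<sigma>. \<forall>t\<in>{1..horizon G}. \<forall>c\<in>realz G (com G t).
      \<forall>g\<in>(\<Pi>\<^sub>E s\<in>{1..<t}. prescrs G P1 s \<times> prescrs G P2 s). \<sigma> t c g \<in> prescrs G i t}"

text \<open>\<open>play G \<sigma>1 \<sigma>2 \<omega> n\<close> consists of the actions and prescriptions at times \<open>1..n\<close>; entries at
  other times are \<open>undefined\<close>.\<close>

primrec play :: "('m,'x,'u,'y,'w) game \<Rightarrow> ('y, 'u) strategy \<Rightarrow> ('y, 'u) strategy \<Rightarrow> 'm \<Rightarrow> nat
                   \<Rightarrow> (player \<Rightarrow> nat \<Rightarrow> 'u) \<times> ('y, 'u) prhist" where
  "play G \<sigma>1 \<sigma>2 \<omega> 0 = ((\<lambda>_ _. undefined), (\<lambda>_. undefined))"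
| "play G \<sigma>1 \<sigma>2 \<omega> (Suc n) =
     (let t = Suc n;
          (u, g) = play G \<sigma>1 \<sigma>2 \<omega> n;
          c = realized G \<omega> u (com G t);
          \<gamma>1 = \<sigma>1 t c g;
          \<gamma>2 = \<sigma>2 t c g;
          u1 = kappa G (\<gamma>1 (realized G \<omega> u (priv G P1 t))) (rnd G P1 t \<omega>);
          u2 = kappa G (\<gamma>2 (realized G \<omega> u (priv G P2 t))) (rnd G P2 t \<omega>)
      in (u(P1 := (u P1)(t := u1), P2 := (u P2)(t := u2)), g(t := (\<gamma>1, \<gamma>2))))"

definition game_cost :: "('m,'x,'u,'y,'w) game \<Rightarrow> ('y, 'u) strategy \<Rightarrow> ('y, 'u) strategy \<Rightarrow> real" where
  "game_cost G \<sigma>1 \<sigma>2 =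
     (\<integral>\<omega>. (let u = fst (play G \<sigma>1 \<sigma>2 \<omega> (horizon G))
           in \<Sum>t=1..horizon G. cost G t (state_at G \<omega> u t) (u P1 t) (u P2 t)) \<partial>(space_of G))"

text \<open>Costs are bounded and all strategy and prescription sets are nonempty, so the real-valued
  infima and suprema here and in the dynamic programs below are the genuine ones.\<close>

definition upper_value :: "('m,'x,'u,'y,'w) game \<Rightarrow> real" where
  "upper_value G = (INF \<sigma>1\<in>strategies G P1. SUP \<sigma>2\<in>strategies G P2. game_cost G \<sigma>1 \<sigma>2)"

definition lower_value :: "('m,'x,'u,'y,'w) game \<Rightarrow> real" where
  "lower_value G = (SUP \<sigma>2\<in>strategies G P2. INF \<sigma>1\<in>strategies G P1. game_cost G \<sigma>1 \<sigma>2)"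

definition minmax_strategy :: "('m,'x,'u,'y,'w) game \<Rightarrow> ('y, 'u) strategy \<Rightarrow> bool" where
  "minmax_strategy G \<sigma>1 \<longleftrightarrow> \<sigma>1 \<in> strategies G P1 \<and>
     (SUP \<sigma>2\<in>strategies G P2. game_cost G \<sigma>1 \<sigma>2) = upper_value G"

definition maxmin_strategy :: "('m,'x,'u,'y,'w) game \<Rightarrow> ('y, 'u) strategy \<Rightarrow> bool" where
  "maxmin_strategy G \<sigma>2 \<longleftrightarrow> \<sigma>2 \<in> strategies G P2 \<and>
     (INF \<sigma>1\<in>strategies G P1. game_cost G \<sigma>1 \<sigma>2) = lower_value G"


section \<open>Common information beliefs\<close>

definition kernel :: "('m,'x,'u,'y,'w) game \<Rightarrow> nat
    \<Rightarrow> 'x \<Rightarrow> ('y, 'u) realiz \<Rightarrow> ('y, 'u) realiz \<Rightarrow> 'u \<Rightarrow> 'u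
    \<Rightarrow> 'x \<Rightarrow> ('y, 'u) realiz \<Rightarrow> ('y, 'u) realiz \<Rightarrow> ('y, 'u) realiz \<Rightarrow> real" where
  "kernel G t x p1 p2 u1 u2 x' q1 q2 z = measure (space_of G)
     {\<omega> \<in> space (space_of G).
        (let xn = dyn G t x u1 u2 (snoise G t \<omega>);
             y1 = obs_map G P1 (t + 1) xn u1 u2 (onoise G P1 (t + 1) \<omega>);
             y2 = obs_map G P2 (t + 1) xn u1 u2 (onoise G P2 (t + 1) \<omega>)
         in xn = x' \<and> upd G P1 (t + 1) p1 u1 y1 = q1 \<and> upd G P2 (t + 1) p2 u2 y2 = q2
            \<and> incr G (t + 1) p1 p2 u1 u2 y1 y2 = z)}"

definition P_joint :: "('m,'x,'u,'y,'w) game \<Rightarrow> nat \<Rightarrow> ('x, 'y, 'u) belief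
    \<Rightarrow> ('y, 'u) prescr \<Rightarrow> ('y, 'u) prescr
    \<Rightarrow> ('y, 'u) realiz \<Rightarrow> 'x \<Rightarrow> ('y, 'u) realiz \<Rightarrow> ('y, 'u) realiz \<Rightarrow> real" where
  "P_joint G t \<pi> \<gamma>1 \<gamma>2 z x' q1 q2 =
     (\<Sum>(x, p1, p2)\<in>hidden G t. \<Sum>u1\<in>acts G P1 t. \<Sum>u2\<in>acts G P2 t.
        \<pi> (x, p1, p2) * \<gamma>1 p1 u1 * \<gamma>2 p2 u2 * kernel G t x p1 p2 u1 u2 x' q1 q2 z)"

definition P_marg :: "('m,'x,'u,'y,'w) game \<Rightarrow> nat \<Rightarrow> ('x, 'y, 'u) belief
    \<Rightarrow> ('y, 'u) prescr \<Rightarrow> ('y, 'u) prescr \<Rightarrow> ('y, 'u) realiz \<Rightarrow> real" where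
  "P_marg G t \<pi> \<gamma>1 \<gamma>2 z = (\<Sum>(x', q1, q2)\<in>hidden G (t + 1). P_joint G t \<pi> \<gamma>1 \<gamma>2 z x' q1 q2)"

definition update :: "('m,'x,'u,'y,'w) game \<Rightarrow> nat \<Rightarrow> ('x, 'y, 'u) belief
    \<Rightarrow> ('y, 'u) prescr \<Rightarrow> ('y, 'u) prescr \<Rightarrow> ('y, 'u) realiz \<Rightarrow> ('x, 'y, 'u) belief" where
  "update G t \<pi> \<gamma>1 \<gamma>2 z =
     (if P_marg G t \<pi> \<gamma>1 \<gamma>2 z > 0
      then (\<lambda>(x', q1, q2). P_joint G t \<pi> \<gamma>1 \<gamma>2 z x' q1 q2 / P_marg G t \<pi> \<gamma>1 \<gamma>2 z)
      else null_update G t \<pi> \<gamma>1 \<gamma>2 z)"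

text \<open>Variables at time 1 involve no actions, so an arbitrary action sequence is plugged in.\<close>

definition realized_init :: "('m,'x,'u,'y,'w) game \<Rightarrow> var set \<Rightarrow> 'm \<Rightarrow> ('y, 'u) realiz" where
  "realized_init G A \<omega> = realized G \<omega> (\<lambda>_ _. undefined) A"

definition prior :: "('m,'x,'u,'y,'w) game \<Rightarrow> ('y, 'u) realiz \<Rightarrow> ('x, 'y, 'u) belief" where
  "prior G c =
     (if measure (space_of G) {\<omega> \<in> space (space_of G). realized_init G (com G 1) \<omega> = c} > 0
      then (\<lambda>(x, p1, p2). cond_prob (space_of G)
              (\<lambda>\<omega>. x_init G \<omega> = x \<and> realized_init G (priv G P1 1) \<omega> = p1
                    \<and> realized_init G (priv G P2 1) \<omega> = p2)
              (\<lambda>\<omega>. realized_init G (com G 1) \<omega> = c))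
      else null_prior G c)"

definition init_belief :: "('m,'x,'u,'y,'w) game \<Rightarrow> 'm \<Rightarrow> ('x, 'y, 'u) belief" where
  "init_belief G \<omega> = prior G (realized_init G (com G 1) \<omega>)"

fun cib :: "('m,'x,'u,'y,'w) game \<Rightarrow> ('y, 'u) realiz \<Rightarrow> ('y, 'u) prhist \<Rightarrow> nat \<Rightarrow> ('x, 'y, 'u) belief" where
  "cib G c g 0 = prior G (restrict c (com G 1))"
| "cib G c g (Suc 0) = prior G (restrict c (com G 1))"
| "cib G c g (Suc (Suc n)) =
     update G (Suc n) (cib G c g (Suc n)) (fst (g (Suc n))) (snd (g (Suc n)))
       (restrict c (inc G (Suc (Suc n))))"


section \<open>Dynamic programs\<close>

definition stage_cost :: "('m,'x,'u,'y,'w) game \<Rightarrow> nat \<Rightarrow> ('x, 'y, 'u) belief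
    \<Rightarrow> ('y, 'u) prescr \<Rightarrow> ('y, 'u) prescr \<Rightarrow> real" where
  "stage_cost G t \<pi> \<gamma>1 \<gamma>2 =
     (\<Sum>(x, p1, p2)\<in>hidden G t. \<Sum>u1\<in>acts G P1 t. \<Sum>u2\<in>acts G P2 t.
        cost G t x u1 u2 * \<pi> (x, p1, p2) * \<gamma>1 p1 u1 * \<gamma>2 p2 u2)"

definition q_value :: "('m,'x,'u,'y,'w) game \<Rightarrow> nat \<Rightarrow> (('x, 'y, 'u) belief \<Rightarrow> real)
    \<Rightarrow> ('x, 'y, 'u) belief \<Rightarrow> ('y, 'u) prescr \<Rightarrow> ('y, 'u) prescr \<Rightarrow> real" where
  "q_value G t V \<pi> \<gamma>1 \<gamma>2 = stage_cost G t \<pi> \<gamma>1 \<gamma>2 +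
     (\<Sum>z\<in>realz G (inc G (t + 1)). P_marg G t \<pi> \<gamma>1 \<gamma>2 z * V (update G t \<pi> \<gamma>1 \<gamma>2 z))"

function V_upper :: "('m,'x,'u,'y,'w) game \<Rightarrow> nat \<Rightarrow> ('x, 'y, 'u) belief \<Rightarrow> real" where
  "V_upper G t = (if horizon G < t then (\<lambda>\<pi>. 0)
     else (\<lambda>\<pi>. INF \<gamma>1\<in>prescrs G P1 t. SUP \<gamma>2\<in>prescrs G P2 t.
             q_value G t (V_upper G (Suc t)) \<pi> \<gamma>1 \<gamma>2))"
  by pat_completeness auto
termination by (relation "Wellfounded.measure (\<lambda>(G, t). Suc (horizon G) - t)") auto

function V_lower :: "('m,'x,'u,'y,'w) game \<Rightarrow> nat \<Rightarrow> ('x, 'y, 'u) belief \<Rightarrow> real" where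
  "V_lower G t = (if horizon G < t then (\<lambda>\<pi>. 0)
     else (\<lambda>\<pi>. SUP \<gamma>2\<in>prescrs G P2 t. INF \<gamma>1\<in>prescrs G P1 t.
             q_value G t (V_lower G (Suc t)) \<pi> \<gamma>1 \<gamma>2))"
  by pat_completeness auto
termination by (relation "Wellfounded.measure (\<lambda>(G, t). Suc (horizon G) - t)") auto

declare V_upper.simps [simp del] V_lower.simps [simp del]

definition w_upper :: "('m,'x,'u,'y,'w) game \<Rightarrow> nat \<Rightarrow> ('x, 'y, 'u) belief
    \<Rightarrow> ('y, 'u) prescr \<Rightarrow> ('y, 'u) prescr \<Rightarrow> real" where
  "w_upper G t = q_value G t (V_upper G (Suc t))"

definition w_lower :: "('m,'x,'u,'y,'w) game \<Rightarrow> nat \<Rightarrow> ('x, 'y, 'u) belief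
    \<Rightarrow> ('y, 'u) prescr \<Rightarrow> ('y, 'u) prescr \<Rightarrow> real" where
  "w_lower G t = q_value G t (V_lower G (Suc t))"

text \<open>The maps $\Xi^1$ and $\Xi^2$; the maximum (minimum) is attained as part of the definition.\<close>

definition minmax_selector :: "('m,'x,'u,'y,'w) game
    \<Rightarrow> (nat \<Rightarrow> ('x, 'y, 'u) belief \<Rightarrow> ('y, 'u) prescr) \<Rightarrow> bool" where
  "minmax_selector G \<Xi> \<longleftrightarrow> (\<forall>t\<in>{1..horizon G}.
     \<Xi> t \<in> measurable (belief_space G t) (prescr_space G P1 t) \<and>
     (\<forall>\<pi>\<in>beliefs G t.
        (\<exists>\<gamma>2\<in>prescrs G P2 t. V_upper G t \<pi> = w_upper G t \<pi> (\<Xi> t \<pi>) \<gamma>2) \<and>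
        (\<forall>\<gamma>2\<in>prescrs G P2 t. w_upper G t \<pi> (\<Xi> t \<pi>) \<gamma>2 \<le> V_upper G t \<pi>)))"

definition maxmin_selector :: "('m,'x,'u,'y,'w) game
    \<Rightarrow> (nat \<Rightarrow> ('x, 'y, 'u) belief \<Rightarrow> ('y, 'u) prescr) \<Rightarrow> bool" where
  "maxmin_selector G \<Xi> \<longleftrightarrow> (\<forall>t\<in>{1..horizon G}.
     \<Xi> t \<in> measurable (belief_space G t) (prescr_space G P2 t) \<and>
     (\<forall>\<pi>\<in>beliefs G t.
        (\<exists>\<gamma>1\<in>prescrs G P1 t. V_lower G t \<pi> = w_lower G t \<pi> \<gamma>1 (\<Xi> t \<pi>)) \<and>
        (\<forall>\<gamma>1\<in>prescrs G P1 t. V_lower G t \<pi> \<le> w_lower G t \<pi> \<gamma>1 (\<Xi> t \<pi>))))"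

definition belief_strategy :: "('m,'x,'u,'y,'w) game
    \<Rightarrow> (nat \<Rightarrow> ('x, 'y, 'u) belief \<Rightarrow> ('y, 'u) prescr) \<Rightarrow> ('y, 'u) strategy" where
  "belief_strategy G \<Xi> = (\<lambda>t c g. \<Xi> t (cib G c g t))"

end

theory Submission
  imports Defs
begin

text \<open>
  For a pair of pure strategies the prescriptions are functions of the common information, so
  the common information belief is the true conditional law of state and private information. The
  cost of the pair therefore equals the value function at time 1 plus the expected one-step defects
  of the dynamic programming equation along the play. Strategies need not be measurable, so
  \<open>\<epsilon>\<close>-optimal prescriptions can be chosen belief by belief: doing so for the minimizer
  keeps every defect below \<open>\<epsilon>\<close>, and letting the maximizer answer
  \<open>\<epsilon>\<close>-optimally to the prescription that a given opponent is about to use keeps every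
  defect above \<open>-\<epsilon>\<close>. The max-min program is symmetric.
\<close>


section \<open>Finitely valued random variables\<close>

text \<open>Strategies are arbitrary functions, and \<open>kappa\<close> is measurable only for each
  fixed distribution, so measurability of the play has to come from finiteness: for a fixed pair of
  strategies each action is \<open>kappa\<close> at one of finitely many distributions, selected by
  common and private information. All system variables are therefore simple functions. The second
  obstacle is realizations of probability zero. Correctness of the belief is stated as P(C_t = c,
  H_t = h) = mu_t(c) * pi_t(h), where H_t is the state with both private informations; nothing is
  divided, and on null realizations both sides vanish. Independence is used for a factorization at
  one point only: past, the two randomizations at time t, and the noise of the next transition. The
  expected defects telescope for any family W of functions of the belief with W_{T+1} = 0, so a
  single identity serves both programs.\<close>

lemma simple_function_finite_dependence:
  assumes f: "simple_function M f"
    and h: "\<And>v. v \<in> f ` space M \<Longrightarrow> simple_function M (h v)"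
  shows "simple_function M (\<lambda>\<omega>. h (f \<omega>) \<omega>)"
  unfolding simple_function_def
proof (intro conjI ballI)
  have "(\<lambda>\<omega>. h (f \<omega>) \<omega>) ` space M \<subseteq> (\<Union>v\<in>f ` space M. h v ` space M)" by auto
  moreover have "finite (\<Union>v\<in>f ` space M. h v ` space M)"
    by (rule finite_UN_I) (use simple_functionD(1)[OF f] simple_functionD(1)[OF h] in auto)
  ultimately show "finite ((\<lambda>\<omega>. h (f \<omega>) \<omega>) ` space M)" by (rule finite_subset)
next
  fix y
  have "(\<lambda>\<omega>. h (f \<omega>) \<omega>) -` {y} \<inter> space M =
      (\<Union>v\<in>f ` space M. (f -` {v} \<inter> space M) \<inter> (h v -` {y} \<inter> space M))" by auto
  also have "\<dots> \<in> sets M"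
    by (intro sets.finite_UN sets.Int simple_functionD(1)[OF f] simple_functionD(2)[OF f]
        simple_functionD(2)[OF h])
  finally show "(\<lambda>\<omega>. h (f \<omega>) \<omega>) -` {y} \<inter> space M \<in> sets M" .
qed

lemma simple_function_restrict:
  assumes "finite A" and "\<And>a. a \<in> A \<Longrightarrow> simple_function M (\<lambda>\<omega>. f \<omega> a)"
  shows "simple_function M (\<lambda>\<omega>. restrict (f \<omega>) A)"
  using assms
proof (induction A)
  case empty
  then show ?case by simp
next
  case (insert a A)
  have "simple_function M (\<lambda>\<omega>. (restrict (f \<omega>) A)(a := f \<omega> a))"
    using insert.IH[OF insert.prems, OF insertI2] insert.prems[OF insertI1]
    by (rule simple_function_compose2[where h = "\<lambda>r y. r(a := y)"])
  moreover have "(\<lambda>\<omega>. (restrict (f \<omega>) A)(a := f \<omega> a)) = (\<lambda>\<omega>. restrict (f \<omega>) (insert a A))"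
    by (auto simp: fun_eq_iff)
  ultimately show ?case by (simp only:)
qed

lemma simple_function_event:
  assumes "simple_function M f"
  shows "{\<omega> \<in> space M. P (f \<omega>)} \<in> sets M"
proof -
  have "{\<omega> \<in> space M. P (f \<omega>)} = f -` {v. P v} \<inter> space M" by auto
  also have "\<dots> \<in> sets M" using assms by (rule simple_functionD(2))
  finally show ?thesis .
qed

lemma (in prob_space) prob_partition:
  assumes f: "simple_function M f" and S: "finite S" "\<And>\<omega>. \<omega> \<in> space M \<Longrightarrow> f \<omega> \<in> S"
    and P: "{\<omega> \<in> space M. P \<omega>} \<in> events"
  shows "prob {\<omega> \<in> space M. P \<omega>} = (\<Sum>s\<in>S. prob {\<omega> \<in> space M. P \<omega> \<and> f \<omega> = s})"
proof -
  have ev: "{\<omega> \<in> space M. P \<omega> \<and> f \<omega> = s} \<in> events" for s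
  proof -
    have "{\<omega> \<in> space M. P \<omega> \<and> f \<omega> = s} = {\<omega> \<in> space M. P \<omega>} \<inter> {\<omega> \<in> space M. f \<omega> = s}" by auto
    then show ?thesis using P simple_function_event[OF f, of "\<lambda>v. v = s"] by auto
  qed
  have "{\<omega> \<in> space M. P \<omega>} = (\<Union>s\<in>S. {\<omega> \<in> space M. P \<omega> \<and> f \<omega> = s})" using S by auto
  then show ?thesis
    using finite_measure_finite_Union[of S "\<lambda>s. {\<omega> \<in> space M. P \<omega> \<and> f \<omega> = s}"] S ev
    by (auto simp: disjoint_family_on_def image_subset_iff)
qed

lemma (in prob_space) integrable_simple:
  fixes g :: "'b \<Rightarrow> real"
  assumes f: "simple_function M f"
  shows "integrable M (\<lambda>\<omega>. g (f \<omega>))"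
proof (rule integrable_const_bound)
  have "finite ((\<lambda>\<omega>. \<bar>g (f \<omega>)\<bar>) ` space M)"
    using simple_functionD(1)[OF simple_function_compose1[OF f, of "\<lambda>v. \<bar>g v\<bar>"]] .
  then show "AE \<omega> in M. norm (g (f \<omega>)) \<le> Max ((\<lambda>\<omega>. \<bar>g (f \<omega>)\<bar>) ` space M)"
    by (intro AE_I2) auto
  show "(\<lambda>\<omega>. g (f \<omega>)) \<in> borel_measurable M"
    by (rule borel_measurable_simple_function, rule simple_function_compose1[OF f])
qed

text \<open>\<open>S\<close> only has to contain the values of \<open>f\<close>; later index sets
  such as \<open>realz G (com G t)\<close> may include values that are never taken.\<close>

lemma (in prob_space) expectation_simple:
  fixes g :: "'b \<Rightarrow> real"
  assumes f: "simple_function M f" and S: "finite S" "\<And>\<omega>. \<omega> \<in> space M \<Longrightarrow> f \<omega> \<in> S"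
  shows "expectation (\<lambda>\<omega>. g (f \<omega>)) = (\<Sum>s\<in>S. g s * prob {\<omega> \<in> space M. f \<omega> = s})"
proof -
  have ev: "{\<omega> \<in> space M. f \<omega> = s} \<in> events" for s by (rule simple_function_event[OF f])
  have "expectation (\<lambda>\<omega>. g (f \<omega>)) = expectation (\<lambda>\<omega>. \<Sum>s\<in>S. g s * indicator {\<omega> \<in> space M. f \<omega> = s} \<omega>)"
  proof (rule Bochner_Integration.integral_cong[OF refl])
    fix \<omega> assume "\<omega> \<in> space M"
    then have "(\<Sum>s\<in>S. g s * indicator {\<omega> \<in> space M. f \<omega> = s} \<omega>) = (\<Sum>s\<in>S. if f \<omega> = s then g s else 0)"
      by (intro sum.cong) (auto simp: indicator_def)
    also have "\<dots> = g (f \<omega>)" using S \<open>\<omega> \<in> space M\<close> by simp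
    finally show "g (f \<omega>) = (\<Sum>s\<in>S. g s * indicator {\<omega> \<in> space M. f \<omega> = s} \<omega>)" by simp
  qed
  also have "\<dots> = (\<Sum>s\<in>S. expectation (\<lambda>\<omega>. g s * indicator {\<omega> \<in> space M. f \<omega> = s} \<omega>))"
    using ev by (intro Bochner_Integration.integral_sum) (auto simp: emeasure_eq_measure)
  also have "\<dots> = (\<Sum>s\<in>S. g s * prob {\<omega> \<in> space M. f \<omega> = s})"
    using ev by (intro sum.cong) auto
  finally show ?thesis .
qed


section \<open>Minimax values of bounded functions\<close>

lemma abs_INF_le:
  fixes f :: "'a \<Rightarrow> real"
  assumes "A \<noteq> {}" "\<And>a. a \<in> A \<Longrightarrow> \<bar>f a\<bar> \<le> B"
  shows "\<bar>INF a\<in>A. f a\<bar> \<le> B"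
proof -
  obtain a where a: "a \<in> A" using assms(1) by auto
  have "bdd_below (f ` A)" by (rule bdd_belowI2[of _ "-B"]) (use assms(2) in fastforce)
  then have "(INF a\<in>A. f a) \<le> f a" using a by (rule cINF_lower)
  moreover have "- B \<le> (INF a\<in>A. f a)"
    using assms(1) by (rule cINF_greatest) (use assms(2) in fastforce)
  ultimately show ?thesis using assms(2)[OF a] by linarith
qed

lemma abs_SUP_le:
  fixes f :: "'a \<Rightarrow> real"
  assumes "A \<noteq> {}" "\<And>a. a \<in> A \<Longrightarrow> \<bar>f a\<bar> \<le> B"
  shows "\<bar>SUP a\<in>A. f a\<bar> \<le> B"
proof -
  obtain a where a: "a \<in> A" using assms(1) by auto
  have "bdd_above (f ` A)" by (rule bdd_aboveI2[of _ _ B]) (use assms(2) in fastforce)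
  then have "f a \<le> (SUP a\<in>A. f a)" using a by (simp add: cSUP_upper)
  moreover have "(SUP a\<in>A. f a) \<le> B"
    using assms(1) by (rule cSUP_least) (use assms(2) in fastforce)
  ultimately show ?thesis using assms(2)[OF a] by linarith
qed

text \<open>Serves two games: the whole game, with strategies as choices, and the one-stage game of
  the dynamic program at a fixed belief, with prescriptions as choices. The uniform bound makes the
  real-valued \<open>INF\<close> and \<open>SUP\<close> genuine.\<close>

locale bounded_payoff =
  fixes S1 :: "'a set" and S2 :: "'b set" and J :: "'a \<Rightarrow> 'b \<Rightarrow> real" and B :: real
  assumes nonempty: "S1 \<noteq> {}" "S2 \<noteq> {}"
    and bounded: "\<And>a b. a \<in> S1 \<Longrightarrow> b \<in> S2 \<Longrightarrow> \<bar>J a b\<bar> \<le> B"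
begin

lemma bdd_above_snd: "a \<in> S1 \<Longrightarrow> bdd_above (J a ` S2)"
  by (rule bdd_aboveI2[of _ _ B]) (use bounded in fastforce)

lemma bdd_below_fst: "b \<in> S2 \<Longrightarrow> bdd_below ((\<lambda>a. J a b) ` S1)"
  by (rule bdd_belowI2[of _ "-B"]) (use bounded in fastforce)

lemma bdd_below_SUP: "bdd_below ((\<lambda>a. SUP b\<in>S2. J a b) ` S1)"
  by (rule bdd_belowI2[of _ "-B"]) (use abs_SUP_le[OF nonempty(2), of "J _" B] bounded in fastforce)

lemma bdd_above_INF: "bdd_above ((\<lambda>b. INF a\<in>S1. J a b) ` S2)"
  by (rule bdd_aboveI2[of _ _ B])
    (use abs_INF_le[OF nonempty(1), of "\<lambda>a. J a _" B] bounded in fastforce)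

text \<open>A choice whose inner supremum is within \<open>e\<close> of the outer infimum is good
  against all \<open>b\<close> at once.\<close>

lemma INF_SUP_near:
  assumes "0 < e"
  shows "\<exists>a\<in>S1. \<forall>b\<in>S2. J a b \<le> (INF a\<in>S1. SUP b\<in>S2. J a b) + e"
proof -
  have "(INF a\<in>S1. SUP b\<in>S2. J a b) < (INF a\<in>S1. SUP b\<in>S2. J a b) + e" using assms by simp
  then obtain a where "a \<in> S1" "(SUP b\<in>S2. J a b) < (INF a\<in>S1. SUP b\<in>S2. J a b) + e"
    using cINF_less_iff[OF nonempty(1) bdd_below_SUP] by blast
  moreover from this have "\<forall>b\<in>S2. J a b \<le> (SUP b\<in>S2. J a b)"
    using cSUP_upper[OF _ bdd_above_snd] by blast
  ultimately show ?thesis by (meson dual_order.trans less_imp_le)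
qed

text \<open>The inner supremum at \<open>a\<close> is at least the outer infimum. The
  near-maximizing \<open>b\<close> may depend on \<open>a\<close>, which is why responses later take
  the opponent's prescription as an argument.\<close>

lemma SUP_response:
  assumes "0 < e" "a \<in> S1"
  shows "\<exists>b\<in>S2. (INF a\<in>S1. SUP b\<in>S2. J a b) - e \<le> J a b"
proof -
  have "(INF a\<in>S1. SUP b\<in>S2. J a b) \<le> (SUP b\<in>S2. J a b)"
    using assms(2) by (rule cINF_lower[OF bdd_below_SUP])
  then have "(INF a\<in>S1. SUP b\<in>S2. J a b) - e < (SUP b\<in>S2. J a b)" using assms(1) by simp
  then show ?thesis using less_cSUP_iff[OF nonempty(2) bdd_above_snd[OF assms(2)]] by fastforce
qed

lemma SUP_INF_near:
  assumes "0 < e"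
  shows "\<exists>b\<in>S2. \<forall>a\<in>S1. (SUP b\<in>S2. INF a\<in>S1. J a b) - e \<le> J a b"
proof -
  have "(SUP b\<in>S2. INF a\<in>S1. J a b) - e < (SUP b\<in>S2. INF a\<in>S1. J a b)" using assms by simp
  then obtain b where "b \<in> S2" "(SUP b\<in>S2. INF a\<in>S1. J a b) - e < (INF a\<in>S1. J a b)"
    using less_cSUP_iff[OF nonempty(2) bdd_above_INF] by blast
  moreover from this have "\<forall>a\<in>S1. (INF a\<in>S1. J a b) \<le> J a b"
    using cINF_lower[OF bdd_below_fst] by blast
  ultimately show ?thesis by (meson dual_order.trans less_imp_le)
qed

lemma INF_response:
  assumes "0 < e" "b \<in> S2"
  shows "\<exists>a\<in>S1. J a b \<le> (SUP b\<in>S2. INF a\<in>S1. J a b) + e"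
proof -
  have "(INF a\<in>S1. J a b) \<le> (SUP b\<in>S2. INF a\<in>S1. J a b)"
    using assms(2) by (rule cSUP_upper[OF _ bdd_above_INF])
  then have "(INF a\<in>S1. J a b) < (SUP b\<in>S2. INF a\<in>S1. J a b) + e" using assms(1) by simp
  then show ?thesis using cINF_less_iff[OF nonempty(1) bdd_below_fst[OF assms(2)]] by fastforce
qed

text \<open>Converse of \<open>INF_SUP_near\<close> and \<open>SUP_response\<close>: the two
  properties characterize the value. They are extracted from the stage games, propagated through
  time, and fed back here for the whole game.\<close>

lemma INF_SUP_eqI:
  assumes "\<And>e. 0 < e \<Longrightarrow> \<exists>a\<in>S1. \<forall>b\<in>S2. J a b \<le> v + e"
    and "\<And>e a. 0 < e \<Longrightarrow> a \<in> S1 \<Longrightarrow> \<exists>b\<in>S2. v - e \<le> J a b"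
  shows "(INF a\<in>S1. SUP b\<in>S2. J a b) = v"
proof (rule antisym)
  show "(INF a\<in>S1. SUP b\<in>S2. J a b) \<le> v"
  proof (rule field_le_epsilon)
    fix e :: real assume "0 < e"
    then obtain a where a: "a \<in> S1" "\<forall>b\<in>S2. J a b \<le> v + e" using assms(1) by blast
    have "(INF a\<in>S1. SUP b\<in>S2. J a b) \<le> (SUP b\<in>S2. J a b)"
      using a(1) by (rule cINF_lower[OF bdd_below_SUP])
    also have "\<dots> \<le> v + e" using a(2) by (intro cSUP_least nonempty) auto
    finally show "(INF a\<in>S1. SUP b\<in>S2. J a b) \<le> v + e" .
  qed
  show "v \<le> (INF a\<in>S1. SUP b\<in>S2. J a b)"
  proof (rule cINF_greatest[OF nonempty(1)], rule field_le_epsilon)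
    fix a and e :: real assume a: "a \<in> S1" and "0 < e"
    then obtain b where b: "b \<in> S2" "v - e \<le> J a b" using assms(2) by blast
    have "J a b \<le> (SUP b\<in>S2. J a b)" using b(1) by (rule cSUP_upper[OF _ bdd_above_snd[OF a]])
    then show "v \<le> (SUP b\<in>S2. J a b) + e" using b(2) by simp
  qed
qed

lemma SUP_INF_eqI:
  assumes "\<And>e. 0 < e \<Longrightarrow> \<exists>b\<in>S2. \<forall>a\<in>S1. v - e \<le> J a b"
    and "\<And>e b. 0 < e \<Longrightarrow> b \<in> S2 \<Longrightarrow> \<exists>a\<in>S1. J a b \<le> v + e"
  shows "(SUP b\<in>S2. INF a\<in>S1. J a b) = v"
proof (rule antisym)
  show "v \<le> (SUP b\<in>S2. INF a\<in>S1. J a b)"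
  proof (rule field_le_epsilon)
    fix e :: real assume "0 < e"
    then obtain b where b: "b \<in> S2" "\<forall>a\<in>S1. v - e \<le> J a b" using assms(1) by blast
    have "v - e \<le> (INF a\<in>S1. J a b)" using b(2) by (intro cINF_greatest nonempty) auto
    also have "\<dots> \<le> (SUP b\<in>S2. INF a\<in>S1. J a b)"
      using b(1) by (rule cSUP_upper[OF _ bdd_above_INF])
    finally show "v \<le> (SUP b\<in>S2. INF a\<in>S1. J a b) + e" by simp
  qed
  show "(SUP b\<in>S2. INF a\<in>S1. J a b) \<le> v"
  proof (rule cSUP_least[OF nonempty(2)], rule field_le_epsilon)
    fix b and e :: real assume b: "b \<in> S2" and "0 < e"
    then obtain a where a: "a \<in> S1" "J a b \<le> v + e" using assms(2) by blast
    have "(INF a\<in>S1. J a b) \<le> J a b" using a(1) by (rule cINF_lower[OF bdd_below_fst[OF b]])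
    then show "(INF a\<in>S1. J a b) \<le> v + e" using a(2) by simp
  qed
qed

end


section \<open>Independence of past, randomization and noise\<close>

context expanded_game
begin

abbreviation T :: nat where "T \<equiv> horizon G"

abbreviation Om :: "'m set" where "Om \<equiv> space (space_of G)"

sublocale prob_space "space_of G" by (rule prob_space_of)

text \<open>Events decided by the sources in \<open>S\<close>. Measurability with respect to it
  records which primitive variables a quantity depends on, so that independence reduces to
  disjointness of source sets.\<close>

definition source_alg :: "source set \<Rightarrow> 'm measure" where
  "source_alg S = sigma Om (\<Union>s\<in>S. source_events G s)"

lemma source_events_subset: "source_events G s \<subseteq> Pow Om"
  by (cases s; simp; metis sets.space_closed space_vimage_algebra)

lemma sets_source_alg: "sets (source_alg S) = sigma_sets Om (\<Union>s\<in>S. source_events G s)"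
  unfolding source_alg_def using source_events_subset by (intro sets_measure_of) blast

lemma space_source_alg [simp]: "space (source_alg S) = Om"
  unfolding source_alg_def using source_events_subset by (intro space_measure_of) blast

lemma source_alg_events:
  assumes "S \<subseteq> sources G"
  shows "sets (source_alg S) \<subseteq> events"
  unfolding sets_source_alg
  using independent assms by (intro sets.sigma_sets_subset) (auto simp: indep_sets_def)

lemma source_events_in_alg: "s \<in> S \<Longrightarrow> source_events G s \<subseteq> sets (source_alg S)"
  unfolding sets_source_alg by (auto intro: sigma_sets.Basic)

lemma simple_function_source_events:
  "simple_function (source_alg S) f \<Longrightarrow> S \<subseteq> sources G \<Longrightarrow> simple_function (space_of G) f"
  using simple_function_subalgebra[of "source_alg S" f "space_of G"] source_alg_events[of S]
  by simp

lemma simple_function_sourceI: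
  assumes "finite (f ` Om)" "s \<in> S"
    "source_events G s = sets (vimage_algebra Om f (count_space UNIV))"
  shows "simple_function (source_alg S) f"
  unfolding simple_function_def
  using assms source_events_in_alg[OF assms(2)] in_vimage_algebra[of _ "count_space UNIV" f Om]
  by auto

lemma simple_x_init: "Init \<in> S \<Longrightarrow> simple_function (source_alg S) (x_init G)"
proof (rule simple_function_sourceI)
  show "finite (x_init G ` Om)"
    by (rule finite_subset[of _ "states G 1"]) (use x_init_states finite_states[of 1] in auto)
qed auto

lemma simple_snoise:
  "SNoise t \<in> S \<Longrightarrow> t \<in> {1..T} \<Longrightarrow> simple_function (source_alg S) (snoise G t)"
  by (rule simple_function_sourceI[OF snoise_finite]) auto

lemma simple_onoise:
  "ONoise i t \<in> S \<Longrightarrow> t \<in> {1..T+1} \<Longrightarrow> simple_function (source_alg S) (onoise G i t)"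
  by (rule simple_function_sourceI[OF onoise_finite]) auto

lemma Int_stable_source_events: "Int_stable (source_events G s)"
  by (cases s) (auto simp: Int_stable_def)

text \<open>The sources of everything realized before the actions of time \<open>t\<close> are
  drawn. Observation noise runs up to \<open>t\<close> inclusive, since observations at
  \<open>t\<close> may belong to the information at \<open>t\<close>; state noise and randomization
  stop at \<open>t - 1\<close>.\<close>

definition past :: "nat \<Rightarrow> source set" where
  "past t = {Init} \<union> SNoise ` {1..<t} \<union> (\<Union>i. ONoise i ` {1..t}) \<union> (\<Union>i. Rand i ` {1..<t})"

text \<open>The noise of the transition from \<open>t\<close> to \<open>t + 1\<close>: the state
  noise has index \<open>t\<close>, the observation noise index \<open>t + 1\<close>.\<close>

definition fresh :: "nat \<Rightarrow> source set" where
  "fresh t = {SNoise t, ONoise P1 (t + 1), ONoise P2 (t + 1)}"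

lemma mem_past [simp]:
  "Init \<in> past t" "SNoise s \<in> past t \<longleftrightarrow> s \<in> {1..<t}"
  "ONoise i s \<in> past t \<longleftrightarrow> s \<in> {1..t}" "Rand i s \<in> past t \<longleftrightarrow> s \<in> {1..<t}"
  by (auto simp: past_def image_iff)

lemma mem_sources [simp]:
  "Init \<in> sources G" "SNoise s \<in> sources G \<longleftrightarrow> s \<in> {1..T}"
  "ONoise i s \<in> sources G \<longleftrightarrow> s \<in> {1..T+1}" "Rand i s \<in> sources G \<longleftrightarrow> s \<in> {1..T}"
  by (auto simp: sources_def image_iff)

lemma past_sources: "t \<le> T + 1 \<Longrightarrow> past t \<subseteq> sources G"
  by (auto simp: past_def)

lemma fresh_sources: "t \<in> {1..T} \<Longrightarrow> fresh t \<subseteq> sources G"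
  by (auto simp: fresh_def)

lemma past_mono: "s \<le> t \<Longrightarrow> past s \<subseteq> past t"
  by (auto simp: past_def)

text \<open>The four blocks of sources are disjoint and every family of source events is closed
  under intersection, so independence passes to the sigma-algebras generated by the blocks.\<close>

lemma prob_past_rand_fresh:
  assumes t: "t \<in> {1..T}"
    and A: "A \<in> sets (source_alg (past t))"
    and B1: "B1 \<in> sets (source_alg {Rand P1 t})"
    and B2: "B2 \<in> sets (source_alg {Rand P2 t})"
    and D: "D \<in> sets (source_alg (fresh t))"
  shows "prob (A \<inter> B1 \<inter> B2 \<inter> D) = prob A * prob B1 * prob B2 * prob D"
proof -
  define I where "I j = [past t, {Rand P1 t}, {Rand P2 t}, fresh t] ! j" for j
  define E where "E j = [A, B1, B2, D] ! j" for j
  have J: "{..<4} = {0, 1, 2, 3::nat}" by auto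
  have "indep_sets (source_events G) (\<Union>j\<in>{..<4}. I j)"
  proof (rule indep_sets_mono_index[OF _ independent])
    show "(\<Union>j\<in>{..<4}. I j) \<subseteq> sources G"
      using past_sources[of t] fresh_sources[of t] t by (auto simp: J I_def)
  qed
  moreover have "disjoint_family_on I {..<4}"
    unfolding disjoint_family_on_def J by (auto simp: I_def fresh_def)
  ultimately have "indep_sets (\<lambda>j. sigma_sets Om (\<Union>s\<in>I j. source_events G s)) {..<4}"
    by (intro indep_sets_collect_sigma Int_stable_source_events)
  then have "indep_sets (\<lambda>j. sets (source_alg (I j))) {..<4}" by (simp add: sets_source_alg)
  then have "prob (\<Inter>j\<in>{..<4}. E j) = (\<Prod>j\<in>{..<4}. prob (E j))"
    by (rule indep_setsD) (use A B1 B2 D in \<open>auto simp: J I_def E_def\<close>)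
  moreover have "(\<Inter>j\<in>{..<4}. E j) = A \<inter> B1 \<inter> B2 \<inter> D" by (auto simp: J E_def)
  ultimately show ?thesis by (simp add: J E_def mult.assoc)
qed

section \<open>Drawing an action from a fixed distribution by uniform randomization\<close>

lemma rnd_range: "t \<in> {1..T} \<Longrightarrow> \<omega> \<in> Om \<Longrightarrow> rnd G i t \<omega> \<in> {0<..1}"
  using measurable_space[OF rnd_rv, of t \<omega> i] by (simp add: space_restrict_space)

lemma kappa_acts:
  assumes "t \<in> {1..T}" "\<delta> \<in> prob_simplex (acts G i t)" "k \<in> {0<..1}"
  shows "kappa G \<delta> k \<in> acts G i t"
  using measurable_space[OF kappa_measurable[OF assms(1,2)], of k] assms(3)
  by (simp add: space_restrict_space)

lemma kappa_level_set:
  assumes "t \<in> {1..T}" "\<delta> \<in> prob_simplex (acts G i t)" "a \<in> acts G i t"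
  shows "{k \<in> {0<..1}. kappa G \<delta> k = a} \<in> sets borel"
proof -
  have "kappa G \<delta> -` {a} \<inter> space (restrict_space borel {0<..1}) \<in> sets (restrict_space borel {0<..1})"
    by (rule measurable_sets[OF kappa_measurable[OF assms(1,2)]]) (use assms(3) in simp)
  moreover have "kappa G \<delta> -` {a} \<inter> space (restrict_space borel {0<..1}) = {k \<in> {0<..1}. kappa G \<delta> k = a}"
    by (auto simp: space_restrict_space)
  ultimately show ?thesis by (subst (asm) sets_restrict_space_iff) auto
qed

lemma kappa_rnd_event_eq:
  assumes "t \<in> {1..T}"
  shows "{\<omega> \<in> Om. kappa G \<delta> (rnd G i t \<omega>) = a} = rnd G i t -` {k \<in> {0<..1}. kappa G \<delta> k = a} \<inter> Om"
  using rnd_range[OF assms, of _ i] by auto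

lemma simple_kappa_rnd:
  assumes "t \<in> {1..T}" "\<delta> \<in> prob_simplex (acts G i t)" "Rand i t \<in> S"
  shows "simple_function (source_alg S) (\<lambda>\<omega>. kappa G \<delta> (rnd G i t \<omega>))"
  unfolding simple_function_def
proof (intro conjI ballI)
  show "finite ((\<lambda>\<omega>. kappa G \<delta> (rnd G i t \<omega>)) ` space (source_alg S))"
    by (rule finite_subset[of _ "acts G i t"])
      (use kappa_acts[OF assms(1,2) rnd_range[OF assms(1)]] finite_acts[OF assms(1)] in auto)
next
  fix a assume "a \<in> (\<lambda>\<omega>. kappa G \<delta> (rnd G i t \<omega>)) ` space (source_alg S)"
  then have a: "a \<in> acts G i t" using kappa_acts[OF assms(1,2) rnd_range[OF assms(1)]] by auto
  have "rnd G i t -` {k \<in> {0<..1}. kappa G \<delta> k = a} \<inter> Om \<in> source_events G (Rand i t)"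
    using in_vimage_algebra[OF kappa_level_set[OF assms(1,2) a], of "rnd G i t" Om] by simp
  then have "{\<omega> \<in> Om. kappa G \<delta> (rnd G i t \<omega>) = a} \<in> sets (source_alg S)"
    using source_events_in_alg[OF assms(3)] unfolding kappa_rnd_event_eq[OF assms(1)] by auto
  moreover have "(\<lambda>\<omega>. kappa G \<delta> (rnd G i t \<omega>)) -` {a} \<inter> space (source_alg S) =
      {\<omega> \<in> Om. kappa G \<delta> (rnd G i t \<omega>) = a}" by auto
  ultimately show "(\<lambda>\<omega>. kappa G \<delta> (rnd G i t \<omega>)) -` {a} \<inter> space (source_alg S) \<in> sets (source_alg S)"
    by simp
qed

lemma prob_kappa_rnd:
  assumes "t \<in> {1..T}" "\<delta> \<in> prob_simplex (acts G i t)" "a \<in> acts G i t"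
  shows "prob {\<omega> \<in> Om. kappa G \<delta> (rnd G i t \<omega>) = a} = \<delta> a"
proof -
  have "rnd G i t \<in> measurable (space_of G) borel"
    using rnd_rv[OF assms(1)] by (rule measurable_restrict_space2_iff[THEN iffD1, THEN conjunct1])
  then have "prob {\<omega> \<in> Om. kappa G \<delta> (rnd G i t \<omega>) = a} =
      measure (distr (space_of G) borel (rnd G i t)) {k \<in> {0<..1}. kappa G \<delta> k = a}"
    unfolding kappa_rnd_event_eq[OF assms(1)] using kappa_level_set[OF assms]
    by (simp add: measure_distr)
  then show ?thesis using kappa_law[OF assms] rnd_uniform[OF assms(1)] by simp
qed


section \<open>Well-typedness of realizations and beliefs\<close>

text \<open>The bound on information sets in \<open>info_available\<close>. Typing, causality and
  measurability are proved for arbitrary subsets of it and so cover common, private and increment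
  variables alike.\<close>

definition avail :: "nat \<Rightarrow> var set" where
  "avail t = {YVar j s |j s. s \<in> {1..t}} \<union> {UVar j s |j s. s \<in> {1..<t}}"

lemma UNIV_player: "UNIV = {P1, P2}"
  using player.exhaust by auto

lemma finite_avail: "finite (avail t)"
proof -
  have "avail t = (\<Union>j\<in>UNIV. YVar j ` {1..t} \<union> UVar j ` {1..<t})"
    by (auto simp: avail_def image_iff)
  then show ?thesis by (simp add: UNIV_player)
qed

lemma com_avail: "t \<in> {1..T+1} \<Longrightarrow> com G t \<subseteq> avail t"
  using info_available[of t P1] by (auto simp: com_def avail_def)

lemma priv_avail: "t \<in> {1..T+1} \<Longrightarrow> priv G i t \<subseteq> avail t"
  using info_available[of t i] by (auto simp: priv_def avail_def)

lemma inc_avail: "t \<in> {1..T+1} \<Longrightarrow> inc G t \<subseteq> avail t"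
  using com_avail[of t] by (auto simp: inc_def)

lemma com_chain:
  assumes "1 \<le> s" "s \<le> t" "t \<le> T + 1"
  shows "com G s \<subseteq> com G t"
  using assms(2,3)
proof (induction t rule: dec_induct)
  case (step n)
  then show ?case using com_mono[of n] assms(1) by auto
qed simp

lemma finite_realz:
  assumes "A \<subseteq> avail t" "t \<le> T + 1"
  shows "finite (realz G A)"
  unfolding realz_def
proof (rule finite_PiE)
  show "finite A" using assms(1) finite_avail by (rule finite_subset)
  show "finite (var_range G a)" if "a \<in> A" for a
    using that assms finite_obs finite_acts by (cases a) (auto simp: avail_def)
qed

lemma restrict_realz: "c \<in> realz G B \<Longrightarrow> A \<subseteq> B \<Longrightarrow> restrict c A \<in> realz G A"
  by (auto simp: realz_def)

lemma finite_hidden: "t \<in> {1..T+1} \<Longrightarrow> finite (hidden G t)"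
  unfolding hidden_def using finite_states finite_realz[OF priv_avail] by auto

lemma state_at_states:
  assumes "1 \<le> t" "t \<le> T + 1" "\<omega> \<in> Om" "\<And>i s. s \<in> {1..<t} \<Longrightarrow> u i s \<in> acts G i s"
  shows "state_at G \<omega> u t \<in> states G t"
  using assms(1,2,4)
proof (induction t rule: dec_induct)
  case base
  then show ?case using x_init_states assms(3) by simp
next
  case (step n)
  obtain m where n: "n = Suc m" using step.hyps(1) by (cases n) auto
  show ?case using step dyn_states[of n _ _ _ \<omega>] assms(3) unfolding n by simp
qed

lemma obs_at_obs:
  assumes "1 \<le> t" "t \<le> T + 1" "\<omega> \<in> Om" "\<And>i s. s \<in> {1..<t} \<Longrightarrow> u i s \<in> acts G i s"
  shows "obs_at G \<omega> u i t \<in> obs G i t"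
proof (cases "t = 1")
  case True
  then show ?thesis
    using obs_init_obs[OF x_init_states, of \<omega> \<omega> i] assms(3) by (simp add: obs_at_def)
next
  case False
  then have t: "t - 1 \<in> {1..T}" "t - 1 + 1 = t" using assms by auto
  have u: "u j (t - 1) \<in> acts G j (t - 1)" for j using t assms(4) by simp
  show ?thesis
    using obs_map_obs[OF t(1) _ u u assms(3), of "state_at G \<omega> u t" i] state_at_states[OF assms] False
    unfolding t(2) by (simp add: obs_at_def)
qed

lemma realized_realz:
  assumes "t \<le> T + 1" "\<omega> \<in> Om" "\<And>i s. s \<in> {1..<t} \<Longrightarrow> u i s \<in> acts G i s" "A \<subseteq> avail t"
  shows "realized G \<omega> u A \<in> realz G A"
  unfolding realized_def realz_def
proof (rule restrict_PiE_iff[THEN iffD2], rule ballI)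
  fix a assume "a \<in> A"
  then have "a \<in> avail t" using assms(4) by auto
  then show "value_at G \<omega> u a \<in> var_range G a"
    using assms obs_at_obs[of _ \<omega> u] by (cases a) (auto simp: avail_def)
qed

section \<open>Causality and measurability of the system variables\<close>

lemma state_at_cong:
  assumes "\<And>i s. s \<in> {1..<t} \<Longrightarrow> u i s = v i s"
  shows "state_at G \<omega> u t = state_at G \<omega> v t"
  using assms
proof (induction t)
  case (Suc n)
  then show ?case by (cases n) auto
qed simp

lemma obs_at_cong:
  assumes "\<And>i s. s \<in> {1..<t} \<Longrightarrow> u i s = v i s" "1 \<le> t"
  shows "obs_at G \<omega> u i t = obs_at G \<omega> v i t"
  using assms state_at_cong[of t u v \<omega>] by (auto simp: obs_at_def)

text \<open>Names in \<open>avail t\<close> involve only actions strictly before \<open>t\<close>.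
  This identifies values along a partial play with those along the completed play.\<close>

lemma realized_cong:
  assumes "\<And>i s. s \<in> {1..<t} \<Longrightarrow> u i s = v i s" "A \<subseteq> avail t"
  shows "realized G \<omega> u A = realized G \<omega> v A"
  unfolding realized_def
proof (rule restrict_ext)
  fix a assume "a \<in> A"
  then have "a \<in> avail t" using assms(2) by auto
  then show "value_at G \<omega> u a = value_at G \<omega> v a"
  proof (cases a)
    case (YVar j s)
    then show ?thesis using \<open>a \<in> avail t\<close> obs_at_cong[of s u v \<omega> j] assms(1) by (auto simp: avail_def)
  next
    case (UVar j s)
    then show ?thesis using \<open>a \<in> avail t\<close> assms(1) by (auto simp: avail_def)
  qed
qed

text \<open>The actions may themselves be random. Simplicity is assumed only for those before
  \<open>t\<close>, which is what the induction over time in \<open>simple_act\<close> can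
  supply.\<close>

lemma simple_state_at:
  assumes U: "\<And>i s. s \<in> {1..<t} \<Longrightarrow> simple_function (source_alg S) (\<lambda>\<omega>. U \<omega> i s)"
    and "1 \<le> t" "t \<le> T + 1" "past t \<subseteq> S"
  shows "simple_function (source_alg S) (\<lambda>\<omega>. state_at G \<omega> (U \<omega>) t)"
  using assms(2,3,4) U
proof (induction t rule: dec_induct)
  case base
  then show ?case using simple_x_init[of S] by (simp add: past_def)
next
  case (step n)
  obtain m where n: "n = Suc m" using step.hyps(1) by (cases n) auto
  have st: "simple_function (source_alg S) (\<lambda>\<omega>. state_at G \<omega> (U \<omega>) n)"
    using step.prems past_mono[of n "Suc n"] by (intro step.IH) auto
  have u: "simple_function (source_alg S) (\<lambda>\<omega>. U \<omega> i n)" for i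
    using step by auto
  have w: "simple_function (source_alg S) (snoise G n)"
    using step by (intro simple_snoise) (auto simp: past_def)
  show ?case
    using simple_function_compose1[OF simple_function_Pair[OF simple_function_Pair[OF st w]
        simple_function_Pair[OF u[of P1] u[of P2]]], where g = "\<lambda>((x, w), (u1, u2)). dyn G n x u1 u2 w"]
    unfolding n by simp
qed

lemma simple_obs_at:
  assumes U: "\<And>i s. s \<in> {1..<t} \<Longrightarrow> simple_function (source_alg S) (\<lambda>\<omega>. U \<omega> i s)"
    and t: "1 \<le> t" "t \<le> T + 1" "past t \<subseteq> S"
  shows "simple_function (source_alg S) (\<lambda>\<omega>. obs_at G \<omega> (U \<omega>) i t)"
proof -
  note st = simple_state_at[OF assms]
  have w: "simple_function (source_alg S) (onoise G i t)"
    using t subsetD[OF t(3), of "ONoise i t"] by (intro simple_onoise) auto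
  show ?thesis
  proof (cases "t = 1")
    case True
    have "simple_function (source_alg S) (\<lambda>\<omega>. obs_init G i (state_at G \<omega> (U \<omega>) 1) (onoise G i 1 \<omega>))"
      using st w True by (intro simple_function_compose2[where h = "obs_init G i"]) auto
    then show ?thesis using True by (simp add: obs_at_def)
  next
    case False
    have u: "simple_function (source_alg S) (\<lambda>\<omega>. U \<omega> j (t - 1))" for j
      using False t by (intro U) auto
    show ?thesis
      using simple_function_compose1[OF simple_function_Pair[OF simple_function_Pair[OF st w]
          simple_function_Pair[OF u[of P1] u[of P2]]], where g = "\<lambda>((x, w), (u1, u2)). obs_map G i t x u1 u2 w"] False
      by (simp add: obs_at_def)
  qed
qed

lemma simple_realized:
  assumes U: "\<And>i s. s \<in> {1..<t} \<Longrightarrow> simple_function (source_alg S) (\<lambda>\<omega>. U \<omega> i s)"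
    and t: "t \<le> T + 1" "past t \<subseteq> S" and A: "A \<subseteq> avail t"
  shows "simple_function (source_alg S) (\<lambda>\<omega>. realized G \<omega> (U \<omega>) A)"
  unfolding realized_def
proof (rule simple_function_restrict)
  show "finite A" using A finite_avail by (rule finite_subset)
  fix a assume "a \<in> A"
  then have a: "a \<in> avail t" using A by auto
  show "simple_function (source_alg S) (\<lambda>\<omega>. value_at G \<omega> (U \<omega>) a)"
  proof (cases a)
    case (YVar j s)
    then have s: "s \<in> {1..t}" using a by (auto simp: avail_def)
    have "simple_function (source_alg S) (\<lambda>\<omega>. obs_at G \<omega> (U \<omega>) j s)"
      using s t past_mono[of s t] by (intro simple_obs_at U) auto
    then show ?thesis using YVar simple_function_compose1[of _ _ Inl] by simp
  next
    case (UVar j s)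
    then have "s \<in> {1..<t}" using a by (auto simp: avail_def)
    then show ?thesis using UVar simple_function_compose1[OF U[of s j], of Inr] by simp
  qed
qed


section \<open>One-step transitions and the belief update\<close>

definition situations :: "nat \<Rightarrow> (('x \<times> ('y,'u) realiz \<times> ('y,'u) realiz) \<times> 'u \<times> 'u) set" where
  "situations t = hidden G t \<times> acts G P1 t \<times> acts G P2 t"

definition situation_cost :: "nat \<Rightarrow> ('x \<times> ('y,'u) realiz \<times> ('y,'u) realiz) \<times> 'u \<times> 'u \<Rightarrow> real" where
  "situation_cost t = (\<lambda>((x, p1, p2), u1, u2). cost G t x u1 u2)"

text \<open>Mass of a situation when the hidden triple has law \<open>\<pi>\<close> and the players
  randomize independently through their prescriptions.\<close>

definition weight :: "('x,'y,'u) belief \<Rightarrow> ('y,'u) prescr \<Rightarrow> ('y,'u) prescr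
    \<Rightarrow> ('x \<times> ('y,'u) realiz \<times> ('y,'u) realiz) \<times> 'u \<times> 'u \<Rightarrow> real" where
  "weight \<pi> \<gamma>1 \<gamma>2 = (\<lambda>((x, p1, p2), u1, u2). \<pi> (x, p1, p2) * \<gamma>1 p1 u1 * \<gamma>2 p2 u2)"

text \<open>The transition as a random map driven by the fresh noise; \<open>kernel\<close> is its
  law, and its dependence on \<open>fresh t\<close> alone makes it independent of the past.\<close>

definition step :: "nat \<Rightarrow> ('x \<times> ('y,'u) realiz \<times> ('y,'u) realiz) \<times> 'u \<times> 'u \<Rightarrow> 'm
    \<Rightarrow> ('x \<times> ('y,'u) realiz \<times> ('y,'u) realiz) \<times> ('y,'u) realiz" where
  "step t = (\<lambda>((x, p1, p2), u1, u2) \<omega>.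
     (let xn = dyn G t x u1 u2 (snoise G t \<omega>);
          y1 = obs_map G P1 (t + 1) xn u1 u2 (onoise G P1 (t + 1) \<omega>);
          y2 = obs_map G P2 (t + 1) xn u1 u2 (onoise G P2 (t + 1) \<omega>)
      in ((xn, upd G P1 (t + 1) p1 u1 y1, upd G P2 (t + 1) p2 u2 y2),
          incr G (t + 1) p1 p2 u1 u2 y1 y2)))"

definition step_prob :: "nat \<Rightarrow> ('x \<times> ('y,'u) realiz \<times> ('y,'u) realiz) \<times> 'u \<times> 'u
    \<Rightarrow> ('x \<times> ('y,'u) realiz \<times> ('y,'u) realiz) \<times> ('y,'u) realiz \<Rightarrow> real" where
  "step_prob t q s = prob {\<omega> \<in> Om. step t q \<omega> = s}"

lemma finite_situations: "t \<in> {1..T} \<Longrightarrow> finite (situations t)"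
  unfolding situations_def using finite_hidden[of t] finite_acts by auto

lemma kernel_eq_step_prob:
  "kernel G t x p1 p2 u1 u2 x' q1 q2 z = step_prob t ((x, p1, p2), u1, u2) ((x', q1, q2), z)"
  unfolding kernel_def step_prob_def step_def by (auto simp: Let_def intro!: arg_cong[where f = prob])

lemma stage_cost_eq:
  "stage_cost G t \<pi> \<gamma>1 \<gamma>2 =
     (\<Sum>q\<in>situations t. situation_cost t q * weight \<pi> \<gamma>1 \<gamma>2 q)"
  unfolding stage_cost_def situations_def situation_cost_def weight_def
  by (simp add: sum.cartesian_product split_def mult.assoc)

lemma P_joint_eq:
  "P_joint G t \<pi> \<gamma>1 \<gamma>2 z x' q1 q2 =
     (\<Sum>q\<in>situations t. weight \<pi> \<gamma>1 \<gamma>2 q * step_prob t q ((x', q1, q2), z))"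
  unfolding P_joint_def situations_def weight_def kernel_eq_step_prob
  by (simp add: sum.cartesian_product split_def)

lemma step_typed:
  assumes "t \<in> {1..T}" "q \<in> situations t" "\<omega> \<in> Om"
  shows "step t q \<omega> \<in> hidden G (t + 1) \<times> realz G (inc G (t + 1))"
  using assms dyn_states obs_map_obs upd_typed incr_typed
  by (auto simp: step_def Let_def situations_def hidden_def)

lemma simple_step:
  assumes "t \<in> {1..T}"
  shows "simple_function (source_alg (fresh t)) (step t q)"
proof -
  obtain x p1 p2 u1 u2 where q: "q = ((x, p1, p2), u1, u2)" by (metis prod.exhaust)
  have "simple_function (source_alg (fresh t)) (snoise G t)"
    "simple_function (source_alg (fresh t)) (onoise G i (t + 1))" for i
    using assms by (auto intro!: simple_snoise simple_onoise simp: fresh_def) (cases i; simp)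
  note w = simple_function_Pair[OF this(1) simple_function_Pair[OF this(2)[of P1] this(2)[of P2]]]
  show ?thesis
    using simple_function_compose1[OF w, of "\<lambda>(w, w1, w2).
      (let xn = dyn G t x u1 u2 w;
          y1 = obs_map G P1 (t + 1) xn u1 u2 w1;
          y2 = obs_map G P2 (t + 1) xn u1 u2 w2
      in ((xn, upd G P1 (t + 1) p1 u1 y1, upd G P2 (t + 1) p2 u2 y2),
          incr G (t + 1) p1 p2 u1 u2 y1 y2))"]
    by (simp add: q step_def)
qed

lemma step_prob_nonneg: "0 \<le> step_prob t q s"
  by (simp add: step_prob_def)

lemma step_prob_outside:
  assumes "t \<in> {1..T}" "q \<in> situations t" "s \<notin> hidden G (t + 1) \<times> realz G (inc G (t + 1))"
  shows "step_prob t q s = 0"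
proof -
  have "{\<omega> \<in> Om. step t q \<omega> = s} = {}" using step_typed[OF assms(1,2)] assms(3) by blast
  then show ?thesis by (simp add: step_prob_def del: Collect_empty_eq)
qed

lemma finite_next: "t \<in> {1..T} \<Longrightarrow> finite (hidden G (t + 1) \<times> realz G (inc G (t + 1)))"
  using finite_hidden[of "t + 1"] finite_realz[OF inc_avail, of "t + 1"] by auto

lemma sum_step_prob:
  assumes "t \<in> {1..T}" "q \<in> situations t"
  shows "(\<Sum>s\<in>hidden G (t + 1) \<times> realz G (inc G (t + 1)). step_prob t q s) = 1"
proof -
  have "prob {\<omega> \<in> Om. True} =
      (\<Sum>s\<in>hidden G (t + 1) \<times> realz G (inc G (t + 1)). prob {\<omega> \<in> Om. True \<and> step t q \<omega> = s})"
    by (rule prob_partition[OF simple_function_source_events[OF simple_step fresh_sources] finite_next])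
      (use assms step_typed in auto)
  then show ?thesis by (simp add: step_prob_def prob_space)
qed

lemma prescr_simplex:
  "\<gamma> \<in> prescrs G i t \<Longrightarrow> p \<in> realz G (priv G i t) \<Longrightarrow> \<gamma> p \<in> prob_simplex (acts G i t)"
  by (auto simp: prescrs_def)

lemma weight_nonneg:
  assumes "\<pi> \<in> beliefs G t" "\<gamma>1 \<in> prescrs G P1 t" "\<gamma>2 \<in> prescrs G P2 t" "q \<in> situations t"
  shows "0 \<le> weight \<pi> \<gamma>1 \<gamma>2 q"
  using assms prescr_simplex
  by (fastforce simp: weight_def situations_def hidden_def beliefs_def prob_simplex_def)

lemma sum_weight:
  assumes t: "t \<in> {1..T}" and "\<pi> \<in> beliefs G t" "\<gamma>1 \<in> prescrs G P1 t" "\<gamma>2 \<in> prescrs G P2 t"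
  shows "(\<Sum>q\<in>situations t. weight \<pi> \<gamma>1 \<gamma>2 q) = 1"
proof -
  have "(\<Sum>q\<in>situations t. weight \<pi> \<gamma>1 \<gamma>2 q) = (\<Sum>(x, p1, p2)\<in>hidden G t. \<Sum>u1\<in>acts G P1 t. \<Sum>u2\<in>acts G P2 t.
      \<pi> (x, p1, p2) * \<gamma>1 p1 u1 * \<gamma>2 p2 u2)"
    unfolding situations_def weight_def by (simp add: sum.cartesian_product split_def)
  also have "\<dots> = (\<Sum>(x, p1, p2)\<in>hidden G t. \<pi> (x, p1, p2))"
  proof (intro sum.cong refl, clarify)
    fix x p1 p2 assume "(x, p1, p2) \<in> hidden G t"
    then have "\<gamma>1 p1 \<in> prob_simplex (acts G P1 t)" "\<gamma>2 p2 \<in> prob_simplex (acts G P2 t)"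
      using assms prescr_simplex by (auto simp: hidden_def)
    then show "(\<Sum>u1\<in>acts G P1 t. \<Sum>u2\<in>acts G P2 t. \<pi> (x, p1, p2) * \<gamma>1 p1 u1 * \<gamma>2 p2 u2) = \<pi> (x, p1, p2)"
      by (simp add: prob_simplex_def flip: sum_distrib_left sum_distrib_right)
  qed
  also have "\<dots> = 1" using assms(2) by (simp add: beliefs_def prob_simplex_def split_def)
  finally show ?thesis .
qed

context
  fixes t \<pi> \<gamma>1 \<gamma>2
  assumes t: "t \<in> {1..T}" and \<pi>: "\<pi> \<in> beliefs G t"
    and \<gamma>: "\<gamma>1 \<in> prescrs G P1 t" "\<gamma>2 \<in> prescrs G P2 t"
begin

lemma P_joint_nonneg: "0 \<le> P_joint G t \<pi> \<gamma>1 \<gamma>2 z x' q1 q2"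
  unfolding P_joint_eq by (intro sum_nonneg mult_nonneg_nonneg weight_nonneg[OF \<pi> \<gamma>] step_prob_nonneg)

lemma P_joint_outside: "(x', q1, q2) \<notin> hidden G (t + 1) \<Longrightarrow> P_joint G t \<pi> \<gamma>1 \<gamma>2 z x' q1 q2 = 0"
  unfolding P_joint_eq by (intro sum.neutral ballI) (simp add: step_prob_outside[OF t])

lemma P_marg_nonneg: "0 \<le> P_marg G t \<pi> \<gamma>1 \<gamma>2 z"
  unfolding P_marg_def by (intro sum_nonneg) (auto simp: P_joint_nonneg)

lemma sum_P_marg: "(\<Sum>z\<in>realz G (inc G (t + 1)). P_marg G t \<pi> \<gamma>1 \<gamma>2 z) = 1"
proof -
  have "(\<Sum>z\<in>realz G (inc G (t + 1)). P_marg G t \<pi> \<gamma>1 \<gamma>2 z) =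
      (\<Sum>h\<in>hidden G (t + 1). \<Sum>z\<in>realz G (inc G (t + 1)). \<Sum>q\<in>situations t.
         weight \<pi> \<gamma>1 \<gamma>2 q * step_prob t q (h, z))"
    unfolding P_marg_def P_joint_eq by (subst sum.swap) (simp add: split_def)
  also have "\<dots> = (\<Sum>s\<in>hidden G (t + 1) \<times> realz G (inc G (t + 1)). \<Sum>q\<in>situations t.
         weight \<pi> \<gamma>1 \<gamma>2 q * step_prob t q s)"
    by (subst sum.cartesian_product) (simp add: split_def)
  also have "\<dots> = (\<Sum>q\<in>situations t. weight \<pi> \<gamma>1 \<gamma>2 q *
      (\<Sum>s\<in>hidden G (t + 1) \<times> realz G (inc G (t + 1)). step_prob t q s))"
    by (subst sum.swap) (simp add: sum_distrib_left)
  also have "\<dots> = (\<Sum>q\<in>situations t. weight \<pi> \<gamma>1 \<gamma>2 q)"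
    by (intro sum.cong refl) (simp only: sum_step_prob[OF t] mult_1_right)
  finally show ?thesis using sum_weight[OF t \<pi> \<gamma>] by simp
qed

lemma update_beliefs:
  assumes z: "z \<in> realz G (inc G (t + 1))"
  shows "update G t \<pi> \<gamma>1 \<gamma>2 z \<in> beliefs G (t + 1)"
proof (cases "P_marg G t \<pi> \<gamma>1 \<gamma>2 z > 0")
  case True
  have "(\<Sum>a\<in>hidden G (t + 1). update G t \<pi> \<gamma>1 \<gamma>2 z a) = P_marg G t \<pi> \<gamma>1 \<gamma>2 z / P_marg G t \<pi> \<gamma>1 \<gamma>2 z"
    using True unfolding update_def P_marg_def by (simp add: split_def flip: sum_divide_distrib)
  then show ?thesis
    using True P_joint_nonneg P_joint_outside
    by (auto simp: beliefs_def prob_simplex_def update_def)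
next
  case False
  \<comment> \<open>Typing of \<open>null_update\<close> comes from its measurability: a measurable
    map sends the source space into the target space.\<close>
  have "(\<pi>, \<gamma>1, \<gamma>2, z) \<in> space (belief_space G t \<Otimes>\<^sub>M prescr_space G P1 t \<Otimes>\<^sub>M prescr_space G P2 t
      \<Otimes>\<^sub>M count_space (realz G (inc G (t + 1))))"
    using \<pi> \<gamma> z by (simp add: space_pair_measure belief_space_def prescr_space_def space_restrict_space)
  from measurable_space[OF null_update_measurable[OF t] this] show ?thesis
    using False by (simp add: update_def belief_space_def space_restrict_space)
qed

end

lemma prescrs_nonempty:
  assumes "t \<in> {1..T}"
  shows "prescrs G i t \<noteq> {}"
proof -
  obtain a where "a \<in> acts G i t" using finite_acts[OF assms, of i] by auto
  then have "(\<lambda>b. if b = a then 1 else 0) \<in> prob_simplex (acts G i t)"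
    using finite_acts[OF assms, of i] by (auto simp: prob_simplex_def)
  then show ?thesis by (auto simp: prescrs_def PiE_eq_empty_iff)
qed

lemma prior_beliefs:
  assumes c: "c \<in> realz G (com G 1)"
  shows "prior G c \<in> beliefs G 1"
proof (cases "prob {\<omega> \<in> Om. realized_init G (com G 1) \<omega> = c} > 0")
  case False
  then show ?thesis using null_prior_beliefs[OF c] by (simp add: prior_def)
next
  case True
  define h where "h \<omega> = (x_init G \<omega>, realized_init G (priv G P1 1) \<omega>, realized_init G (priv G P2 1) \<omega>)" for \<omega>
  have r: "simple_function (space_of G) (realized_init G A)" if "A \<subseteq> avail 1" for A
    using simple_realized[of 1 "past 1" "\<lambda>_ _ _. undefined" A] that past_sources[of 1]
    by (intro simple_function_source_events[of "past 1"]) (auto simp: realized_init_def[abs_def])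
  have h: "simple_function (space_of G) h"
    unfolding h_def[abs_def] using past_sources[of 1] horizon_pos
    by (intro simple_function_Pair r priv_avail simple_function_source_events[OF simple_x_init]) auto
  have hid: "h \<omega> \<in> hidden G 1" if "\<omega> \<in> Om" for \<omega>
    using that x_init_states realized_realz[of 1 \<omega>] priv_avail[of 1] horizon_pos
    by (auto simp: h_def hidden_def realized_init_def)
  have ev: "{\<omega> \<in> Om. realized_init G (com G 1) \<omega> = c} \<in> events"
    using horizon_pos by (intro simple_function_event[OF r] com_avail) auto
  have pr: "prior G c a = prob {\<omega> \<in> Om. realized_init G (com G 1) \<omega> = c \<and> h \<omega> = a} /
      prob {\<omega> \<in> Om. realized_init G (com G 1) \<omega> = c}" for a
    using True by (cases a) (auto simp: prior_def cond_prob_def h_def conj_ac)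
  have "prior G c a = 0" if "a \<notin> hidden G 1" for a
  proof -
    have "{\<omega> \<in> Om. realized_init G (com G 1) \<omega> = c \<and> h \<omega> = a} = {}" using hid that by auto
    then show ?thesis by (simp only: pr measure_empty div_0)
  qed
  \<comment> \<open>The numerators are the masses of a partition of the conditioning event.\<close>
  moreover have "(\<Sum>a\<in>hidden G 1. prior G c a) = 1"
    unfolding pr sum_divide_distrib[symmetric]
    using prob_partition[OF h finite_hidden hid ev] True horizon_pos by simp
  ultimately show ?thesis by (auto simp: beliefs_def prob_simplex_def pr)
qed

lemma cib_beliefs:
  assumes "1 \<le> t" "t \<le> T + 1" "c \<in> realz G (com G t)"
    "\<And>s. s \<in> {1..<t} \<Longrightarrow> fst (g s) \<in> prescrs G P1 s" "\<And>s. s \<in> {1..<t} \<Longrightarrow> snd (g s) \<in> prescrs G P2 s"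
  shows "cib G c g t \<in> beliefs G t"
proof -
  have "restrict c (com G s) \<in> realz G (com G s)" if "1 \<le> s" "s \<le> t" for s
    using assms that by (intro restrict_realz[OF assms(3)] com_chain) auto
  then have C: "\<And>s. 1 \<le> s \<Longrightarrow> s \<le> t \<Longrightarrow> restrict c (com G s) \<in> realz G (com G s)" .
  have "cib G c g s \<in> beliefs G s" if "1 \<le> s" "s \<le> t" for s
    using that
  proof (induction s rule: dec_induct)
    case base
    then show ?case using C[of 1] prior_beliefs by simp
  next
    case (step n)
    obtain m where n: "n = Suc m" using step.hyps(1) by (cases n) auto
    have "restrict (restrict c (com G (n + 1))) (inc G (n + 1)) \<in> realz G (inc G (n + 1))"
      using C[of "n + 1"] step by (intro restrict_realz) (auto simp: inc_def)
    then have "restrict c (inc G (n + 1)) \<in> realz G (inc G (n + 1))"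
      by (simp add: inc_def Int_absorb1 Int_absorb2 inf.absorb2)
    then show ?case
      using update_beliefs[of n "cib G c g n" "fst (g n)" "snd (g n)"] step assms by (simp add: n)
  qed
  then show ?thesis using assms by simp
qed

end


section \<open>Prescriptions and beliefs as functions of the common information\<close>

declare restrict_apply [simp del]

text \<open>Pure strategies make the prescriptions used up to time \<open>n\<close> a function of the
  realization \<open>c\<close> of the common information.\<close>

primrec ghist :: "('m,'x,'u,'y,'w) game \<Rightarrow> (player \<Rightarrow> ('y,'u) strategy) \<Rightarrow> ('y,'u) realiz \<Rightarrow> nat
    \<Rightarrow> ('y,'u) prhist" where
  "ghist G \<sigma> c 0 = (\<lambda>_. undefined)"
| "ghist G \<sigma> c (Suc n) = (ghist G \<sigma> c n)(Suc n :=
     (\<sigma> P1 (Suc n) (restrict c (com G (Suc n))) (ghist G \<sigma> c n),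
      \<sigma> P2 (Suc n) (restrict c (com G (Suc n))) (ghist G \<sigma> c n)))"

text \<open>A fixed pair of pure strategies, indexed by the player so that one argument covers both
  sides.\<close>

locale played_game = expanded_game G for G :: "('m,'x,'u,'y,'w) game" +
  fixes \<sigma> :: "player \<Rightarrow> ('y,'u) strategy"
  assumes strategies: "\<And>i. \<sigma> i \<in> strategies G i"
begin

text \<open>The prescription at \<open>t\<close> as a function of the common information. The inner
  restriction lets \<open>c\<close> be a realization at a later time too; the history ends at
  \<open>t - 1\<close>, before the choice.\<close>

definition pres :: "player \<Rightarrow> nat \<Rightarrow> ('y,'u) realiz \<Rightarrow> ('y,'u) prescr" where
  "pres i t c = \<sigma> i t (restrict c (com G t)) (ghist G \<sigma> c (t - 1))"

definition bel :: "nat \<Rightarrow> ('y,'u) realiz \<Rightarrow> ('x,'y,'u) belief" where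
  "bel t c = cib G c (ghist G \<sigma> c (t - 1)) t"

lemma ghist_eq: "1 \<le> s \<Longrightarrow> s \<le> n \<Longrightarrow> ghist G \<sigma> c n s = (pres P1 s c, pres P2 s c)"
  by (induction n) (auto simp: pres_def le_Suc_eq)

lemma ghist_outside: "s \<notin> {1..n} \<Longrightarrow> ghist G \<sigma> c n s = undefined"
  by (induction n) auto

lemma restrict_com:
  assumes "1 \<le> s" "s \<le> t" "t \<le> T + 1"
  shows "restrict (restrict c (com G t)) (com G s) = restrict c (com G s)"
  using com_chain[OF assms] by (simp add: Int_absorb1)

text \<open>Common information is nested, so cutting \<open>c\<close> down to time \<open>t\<close>
  leaves its restrictions to earlier times, and hence all earlier choices, unchanged.\<close>

lemma ghist_restrict:
  assumes "n \<le> t" "t \<le> T + 1"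
  shows "ghist G \<sigma> (restrict c (com G t)) n = ghist G \<sigma> c n"
  using assms
proof (induction n)
  case (Suc n)
  have "restrict (restrict c (com G t)) (com G (Suc n)) = restrict c (com G (Suc n))"
    using Suc.prems by (intro restrict_com) auto
  moreover have "ghist G \<sigma> (restrict c (com G t)) n = ghist G \<sigma> c n" using Suc by simp
  ultimately show ?case by (simp only: ghist.simps)
qed simp

lemma pres_restrict:
  assumes "1 \<le> s" "s \<le> t" "t \<le> T + 1"
  shows "pres i s (restrict c (com G t)) = pres i s c"
  using assms by (simp add: pres_def restrict_com ghist_restrict del: restrict_restrict)

text \<open>Strategies are constrained only on well-typed histories, so all earlier choices must be
  typed before the current one; hence the strong induction.\<close>

lemma pres_prescrs:
  assumes "t \<in> {1..T}" "c \<in> realz G (com G t)"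
  shows "pres i t c \<in> prescrs G i t"
  using assms
proof (induction t arbitrary: c i rule: less_induct)
  case (less t)
  have "ghist G \<sigma> c (t - 1) \<in> (\<Pi>\<^sub>E s\<in>{1..<t}. prescrs G P1 s \<times> prescrs G P2 s)"
  proof (rule PiE_I)
    fix s assume s: "s \<in> {1..<t}"
    have "pres i s c \<in> prescrs G i s" for i
    proof -
      have "restrict c (com G s) \<in> realz G (com G s)"
        using s less.prems by (intro restrict_realz[OF less.prems(2) com_chain]) auto
      then have "pres i s (restrict c (com G s)) \<in> prescrs G i s"
        using s less.prems by (intro less.IH) auto
      moreover have "pres i s (restrict c (com G s)) = pres i s c"
        using s less.prems by (intro pres_restrict) auto
      ultimately show ?thesis by (simp only:)
    qed
    then show "ghist G \<sigma> c (t - 1) s \<in> prescrs G P1 s \<times> prescrs G P2 s"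
      using ghist_eq[of s "t - 1" c] s by (cases t) auto
  qed (auto intro!: ghist_outside)
  moreover have "restrict c (com G t) \<in> realz G (com G t)"
    using less.prems restrict_realz by blast
  ultimately show ?case
    using strategies[of i] less.prems unfolding strategies_def pres_def by blast
qed

lemma bel_beliefs:
  assumes "1 \<le> t" "t \<le> T + 1" "c \<in> realz G (com G t)"
  shows "bel t c \<in> beliefs G t"
proof -
  have "pres i s c \<in> prescrs G i s" if "s \<in> {1..<t}" for i s
  proof -
    have "restrict c (com G s) \<in> realz G (com G s)"
      using that assms by (intro restrict_realz[OF assms(3) com_chain]) auto
    then have "pres i s (restrict c (com G s)) \<in> prescrs G i s"
      using that assms by (intro pres_prescrs) auto
    moreover have "pres i s (restrict c (com G s)) = pres i s c"
      using that assms by (intro pres_restrict) auto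
    ultimately show ?thesis by (simp only:)
  qed
  then show ?thesis
    unfolding bel_def using assms by (intro cib_beliefs) (auto simp: ghist_eq)
qed

text \<open>The belief at \<open>t\<close> reads only prescriptions before \<open>t\<close> and
  common information up to \<open>t\<close>; each increment is seen through the common information
  that contains it.\<close>

lemma cib_cong:
  assumes "t \<le> T + 1" "\<And>s. s \<in> {1..<t} \<Longrightarrow> g s = g' s"
    and "\<And>s. s \<in> {1..t} \<Longrightarrow> restrict c (com G s) = restrict c' (com G s)"
  shows "1 \<le> t \<Longrightarrow> cib G c g t = cib G c' g' t"
  using assms
proof (induction t)
  case (Suc n)
  show ?case
  proof (cases n)
    case 0
    have "restrict c (com G 1) = restrict c' (com G 1)" by (intro Suc.prems(4)) simp
    then show ?thesis unfolding 0 by (simp only: cib.simps One_nat_def)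
  next
    case (Suc m)
    have "restrict (restrict c (com G (n + 1))) (inc G (n + 1)) =
        restrict (restrict c' (com G (n + 1))) (inc G (n + 1))"
      using Suc.prems(4)[of "n + 1"] by simp
    then have "restrict c (inc G (n + 1)) = restrict c' (inc G (n + 1))"
      by (simp add: inc_def inf.absorb2 Int_absorb1)
    moreover have "cib G c g n = cib G c' g' n" using Suc.IH Suc.prems Suc by simp
    moreover have "g n = g' n" using Suc by (intro Suc.prems(3)) simp
    ultimately show ?thesis unfolding Suc cib.simps by (simp only: Suc Suc_eq_plus1)
  qed
qed simp

lemma bel_restrict:
  assumes "1 \<le> s" "s \<le> t" "t \<le> T + 1"
  shows "bel s (restrict c (com G t)) = bel s c"
  unfolding bel_def
proof (rule cib_cong)
  fix r assume "r \<in> {1..<s}"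
  then show "ghist G \<sigma> (restrict c (com G t)) (s - 1) r = ghist G \<sigma> c (s - 1) r"
    using assms ghist_restrict[of "s - 1" t c] by simp
next
  fix r assume "r \<in> {1..s}"
  then show "restrict (restrict c (com G t)) (com G r) = restrict c (com G r)"
    using assms by (intro restrict_com) auto
qed (use assms in auto)

lemma bel_Suc:
  assumes "1 \<le> t" "t \<le> T"
  shows "bel (t + 1) c = update G t (bel t c) (pres P1 t c) (pres P2 t c) (restrict c (inc G (t + 1)))"
proof -
  obtain m where m: "t = Suc m" using assms(1) by (cases t) auto
  \<comment> \<open>\<open>bel (t + 1)\<close> uses the history of length \<open>t\<close>,
    \<open>bel t\<close> that of length \<open>t - 1\<close>; the belief at \<open>t\<close> does
    not read the additional entry.\<close>
  have "cib G c (ghist G \<sigma> c t) t = cib G c (ghist G \<sigma> c (t - 1)) t"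
    using assms by (intro cib_cong) (auto simp: ghist_eq)
  then show ?thesis using ghist_eq[of t t c] unfolding bel_def m by (simp del: ghist.simps)
qed


section \<open>The course of play\<close>

text \<open>The action sequence of the whole play. All variables up to time \<open>T + 1\<close> are
  evaluated along it; those at \<open>T + 1\<close> need actions only up to
  \<open>T\<close>.\<close>

definition act :: "'m \<Rightarrow> player \<Rightarrow> nat \<Rightarrow> 'u" where
  "act \<omega> = fst (play G (\<sigma> P1) (\<sigma> P2) \<omega> T)"

definition X :: "nat \<Rightarrow> 'm \<Rightarrow> 'x" where
  "X t \<omega> = state_at G \<omega> (act \<omega>) t"

definition C :: "nat \<Rightarrow> 'm \<Rightarrow> ('y,'u) realiz" where
  "C t \<omega> = realized G \<omega> (act \<omega>) (com G t)"

definition P :: "player \<Rightarrow> nat \<Rightarrow> 'm \<Rightarrow> ('y,'u) realiz" where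
  "P i t \<omega> = realized G \<omega> (act \<omega>) (priv G i t)"

definition Z :: "nat \<Rightarrow> 'm \<Rightarrow> ('y,'u) realiz" where
  "Z t \<omega> = realized G \<omega> (act \<omega>) (inc G t)"

definition H :: "nat \<Rightarrow> 'm \<Rightarrow> 'x \<times> ('y,'u) realiz \<times> ('y,'u) realiz" where
  "H t \<omega> = (X t \<omega>, P P1 t \<omega>, P P2 t \<omega>)"

definition Q :: "nat \<Rightarrow> 'm \<Rightarrow> ('x \<times> ('y,'u) realiz \<times> ('y,'u) realiz) \<times> 'u \<times> 'u" where
  "Q t \<omega> = (H t \<omega>, act \<omega> P1 t, act \<omega> P2 t)"

lemma play_stable:
  assumes "n \<le> m" "s \<le> n"
  shows "fst (play G \<sigma>1 \<sigma>2 \<omega> m) i s = fst (play G \<sigma>1 \<sigma>2 \<omega> n) i s"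
  using assms(1)
proof (induction m rule: dec_induct)
  case (step m)
  then show ?case using assms(2) by (cases i) (auto simp: Let_def split_def)
qed simp

lemma realized_play:
  assumes "n \<le> T" "A \<subseteq> avail (n + 1)"
  shows "realized G \<omega> (fst (play G (\<sigma> P1) (\<sigma> P2) \<omega> n)) A = realized G \<omega> (act \<omega>) A"
  using assms(2) play_stable[OF assms(1)] by (intro realized_cong[of "n + 1"]) (auto simp: act_def)

lemma restrict_C: "1 \<le> s \<Longrightarrow> s \<le> t \<Longrightarrow> t \<le> T + 1 \<Longrightarrow> restrict (C t \<omega>) (com G s) = C s \<omega>"
  by (simp add: C_def realized_def restrict_com del: restrict_restrict)

lemma restrict_C_inc: "restrict (C (t + 1) \<omega>) (inc G (t + 1)) = Z (t + 1) \<omega>"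
  by (simp add: C_def Z_def realized_def inc_def inf.absorb2 Int_absorb1)

text \<open>Each choice depends on the common information and the recorded prescriptions, which
  inductively depend on the common information alone. Any \<open>c\<close> with the right
  restrictions will do, in particular a later realization.\<close>

lemma play_prescriptions:
  assumes "n \<le> T" "\<And>s. s \<in> {1..n} \<Longrightarrow> restrict c (com G s) = C s \<omega>"
  shows "snd (play G (\<sigma> P1) (\<sigma> P2) \<omega> n) = ghist G \<sigma> c n"
  using assms
proof (induction n)
  case (Suc n)
  have "realized G \<omega> (fst (play G (\<sigma> P1) (\<sigma> P2) \<omega> n)) (com G (Suc n)) = restrict c (com G (Suc n))"
    using Suc.prems realized_play[of n "com G (Suc n)"] com_avail[of "Suc n"] by (simp add: C_def)
  then show ?case using Suc by (simp add: Let_def split_def)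
qed simp

text \<open>Turns the recursion over rounds into an equation along the completed play: common and
  private information fix the distribution, and only the random number is new.\<close>

lemma act_eq:
  assumes "t \<in> {1..T}"
  shows "act \<omega> i t = kappa G (pres i t (C t \<omega>) (P i t \<omega>)) (rnd G i t \<omega>)"
proof -
  obtain n where n: "t = Suc n" using assms by (cases t) auto
  have 1: "realized G \<omega> (fst (play G (\<sigma> P1) (\<sigma> P2) \<omega> n)) (com G t) = C t \<omega>"
    using assms realized_play[of n "com G t"] com_avail[of t] by (simp add: n C_def)
  have 2: "realized G \<omega> (fst (play G (\<sigma> P1) (\<sigma> P2) \<omega> n)) (priv G j t) = P j t \<omega>" for j
    using assms realized_play[of n "priv G j t"] priv_avail[of t j] by (simp add: n P_def)
  have 3: "snd (play G (\<sigma> P1) (\<sigma> P2) \<omega> n) = ghist G \<sigma> (C t \<omega>) n"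
    using assms by (intro play_prescriptions restrict_C) (auto simp: n)
  have "act \<omega> i t = fst (play G (\<sigma> P1) (\<sigma> P2) \<omega> t) i t"
    unfolding act_def using assms by (intro play_stable) auto
  also have "\<dots> = kappa G (\<sigma> i t (C t \<omega>) (ghist G \<sigma> (C t \<omega>) n) (P i t \<omega>)) (rnd G i t \<omega>)"
    using 1 2 3 unfolding n by (cases i) (auto simp: Let_def split_def)
  finally show ?thesis using restrict_C[of t t \<omega>] assms by (simp add: pres_def n)
qed

lemma act_acts:
  assumes "t \<in> {1..T}" "\<omega> \<in> Om"
  shows "act \<omega> i t \<in> acts G i t"
  using assms(1)
proof (induction t arbitrary: i rule: less_induct)
  case (less t)
  then have u: "act \<omega> j s \<in> acts G j s" if "s \<in> {1..<t}" for j s using that by auto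
  have "C t \<omega> \<in> realz G (com G t)" "P i t \<omega> \<in> realz G (priv G i t)"
    using less.prems assms(2) u com_avail[of t] priv_avail[of t i]
    by (auto simp: C_def P_def intro!: realized_realz[of t])
  then show ?case
    unfolding act_eq[OF less.prems]
    using less.prems assms(2) by (intro kappa_acts prescr_simplex[OF pres_prescrs] rnd_range)
qed

lemma typed:
  assumes "1 \<le> t" "t \<le> T + 1" "\<omega> \<in> Om"
  shows X_states: "X t \<omega> \<in> states G t" and C_realz: "C t \<omega> \<in> realz G (com G t)"
    and P_realz: "P i t \<omega> \<in> realz G (priv G i t)" and Z_realz: "Z t \<omega> \<in> realz G (inc G t)"
    and H_hidden: "H t \<omega> \<in> hidden G t"
proof -
  have u: "act \<omega> j s \<in> acts G j s" if "s \<in> {1..<t}" for j s using that act_acts assms by auto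
  show X: "X t \<omega> \<in> states G t" unfolding X_def using assms u by (intro state_at_states)
  show "C t \<omega> \<in> realz G (com G t)" unfolding C_def using assms u com_avail[of t] by (intro realized_realz[of t]) auto
  have P: "P i t \<omega> \<in> realz G (priv G i t)" for i
    unfolding P_def using assms u priv_avail[of t] by (intro realized_realz[of t]) auto
  then show "P i t \<omega> \<in> realz G (priv G i t)" .
  show "Z t \<omega> \<in> realz G (inc G t)" unfolding Z_def using assms u inc_avail[of t] by (intro realized_realz[of t]) auto
  show "H t \<omega> \<in> hidden G t" unfolding H_def hidden_def using X P by auto
qed

lemma Q_situations: "t \<in> {1..T} \<Longrightarrow> \<omega> \<in> Om \<Longrightarrow> Q t \<omega> \<in> situations t"
  using H_hidden[of t \<omega>] act_acts[of t \<omega>] by (auto simp: Q_def situations_def)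

text \<open>By strong induction the information at \<open>s\<close> takes finitely many values. For
  each of them the action is \<open>kappa\<close> at a fixed distribution, hence simple, and the
  pieces are glued by \<open>simple_function_finite_dependence\<close>.\<close>

lemma simple_act:
  assumes "s \<in> {1..<t}" "t \<le> T + 1"
  shows "simple_function (source_alg (past t)) (\<lambda>\<omega>. act \<omega> i s)"
  using assms
proof (induction s arbitrary: i t rule: less_induct)
  case (less s)
  have s: "s \<in> {1..T}" using less.prems by auto
  have u: "simple_function (source_alg (past t)) (\<lambda>\<omega>. act \<omega> j r)" if "r \<in> {1..<s}" for j r
    using less that by auto
  have ps: "past s \<subseteq> past t" using less.prems by (intro past_mono) auto
  have f: "simple_function (source_alg (past t)) (\<lambda>\<omega>. (C s \<omega>, P i s \<omega>))"
    unfolding C_def P_def using s ps u com_avail[of s] priv_avail[of s i]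
    by (intro simple_function_Pair simple_realized[of s]) auto
  have "simple_function (source_alg (past t))
      (\<lambda>\<omega>. (\<lambda>(c, p) \<omega>. kappa G (pres i s c p) (rnd G i s \<omega>)) (C s \<omega>, P i s \<omega>) \<omega>)"
  proof (rule simple_function_finite_dependence[OF f])
    fix v assume "v \<in> (\<lambda>\<omega>. (C s \<omega>, P i s \<omega>)) ` space (source_alg (past t))"
    then obtain \<omega> where "\<omega> \<in> Om" "v = (C s \<omega>, P i s \<omega>)" by auto
    then have "pres i s (fst v) (snd v) \<in> prob_simplex (acts G i s)"
      using s C_realz[of s \<omega>] P_realz[of s \<omega> i] by (intro prescr_simplex[OF pres_prescrs]) auto
    then have "simple_function (source_alg (past t))
        (\<lambda>\<omega>. kappa G (pres i s (fst v) (snd v)) (rnd G i s \<omega>))"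
      using s less.prems by (intro simple_kappa_rnd) auto
    then show "simple_function (source_alg (past t))
        ((\<lambda>(c, p) \<omega>. kappa G (pres i s c p) (rnd G i s \<omega>)) v)"
      by (simp add: split_def)
  qed
  then show ?case by (simp add: act_eq[OF s])
qed

lemma simple_past:
  assumes "1 \<le> t" "t \<le> T + 1"
  shows simple_C: "simple_function (source_alg (past t)) (C t)"
    and simple_H: "simple_function (source_alg (past t)) (H t)"
    and simple_Z: "simple_function (source_alg (past t)) (Z t)"
  unfolding C_def[abs_def] H_def[abs_def] P_def[abs_def] X_def[abs_def] Z_def[abs_def]
  using assms simple_act com_avail[of t] priv_avail[of t] inc_avail[of t]
  by (intro simple_function_Pair simple_realized[of t] simple_state_at; auto)+

lemma simple_rv:
  assumes "1 \<le> t" "t \<le> T + 1"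
  shows "simple_function (space_of G) (C t)" "simple_function (space_of G) (H t)"
    "simple_function (space_of G) (Z t)"
  using simple_past[OF assms] past_sources[OF assms(2)] simple_function_source_events by blast+

lemma simple_Q: "t \<in> {1..T} \<Longrightarrow> simple_function (space_of G) (Q t)"
  unfolding Q_def[abs_def]
  using simple_rv(2)[of t] simple_function_source_events[OF simple_act[of t "t + 1"] past_sources]
  by (intro simple_function_Pair) auto

text \<open>The action sequence of the play is well typed, so the standing assumptions
  \<open>incr_eq\<close> and \<open>upd_eq\<close> apply to it.\<close>

lemma step_Q:
  assumes "t \<in> {1..T}" "\<omega> \<in> Om"
  shows "step t (Q t \<omega>) \<omega> = (H (t + 1) \<omega>, Z (t + 1) \<omega>)"
proof -
  obtain n where n: "t = Suc n" using assms by (cases t) auto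
  have x: "dyn G t (X t \<omega>) (act \<omega> P1 t) (act \<omega> P2 t) (snoise G t \<omega>) = X (Suc t) \<omega>"
    by (simp add: X_def n)
  have y: "obs_map G i (Suc t) (X (Suc t) \<omega>) (act \<omega> P1 t) (act \<omega> P2 t) (onoise G i (Suc t) \<omega>) =
      obs_at G \<omega> (act \<omega>) i (Suc t)" for i
    using n by (simp add: X_def obs_at_def)
  show ?thesis
    unfolding Q_def H_def Z_def step_def P_def
    using incr_eq[OF assms, of "act \<omega>"] upd_eq[OF assms, of "act \<omega>"] act_acts assms
    by (simp add: x y Let_def)
qed

lemma finite_com: "1 \<le> t \<Longrightarrow> t \<le> T + 1 \<Longrightarrow> finite (realz G (com G t))"
  by (intro finite_realz[of _ t] com_avail) auto


section \<open>The law of the play\<close>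

text \<open>On the event that information and situation take the given values, each action is
  \<open>kappa\<close> at a fixed distribution and the transition is \<open>step\<close> at a fixed
  argument. Substituting these constants turns the event into an intersection of four independent
  ones.\<close>

lemma prob_step:
  assumes t: "t \<in> {1..T}" and c: "c \<in> realz G (com G t)" and q: "((x, p1, p2), u1, u2) \<in> situations t"
  shows "prob {\<omega> \<in> Om. C t \<omega> = c \<and> Q t \<omega> = ((x, p1, p2), u1, u2) \<and> (H (t + 1) \<omega>, Z (t + 1) \<omega>) = s} =
    prob {\<omega> \<in> Om. C t \<omega> = c \<and> H t \<omega> = (x, p1, p2)} * pres P1 t c p1 u1 * pres P2 t c p2 u2 *
      step_prob t ((x, p1, p2), u1, u2) s"
proof -
  let ?q = "((x, p1, p2), u1, u2)"
  have \<delta>: "pres P1 t c p1 \<in> prob_simplex (acts G P1 t)" "pres P2 t c p2 \<in> prob_simplex (acts G P2 t)"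
    using pres_prescrs[OF t c] prescr_simplex q by (auto simp: situations_def hidden_def)
  have u: "u1 \<in> acts G P1 t" "u2 \<in> acts G P2 t" using q by (auto simp: situations_def)
  let ?A = "{\<omega> \<in> Om. C t \<omega> = c \<and> H t \<omega> = (x, p1, p2)}"
  let ?B1 = "{\<omega> \<in> Om. kappa G (pres P1 t c p1) (rnd G P1 t \<omega>) = u1}"
  let ?B2 = "{\<omega> \<in> Om. kappa G (pres P2 t c p2) (rnd G P2 t \<omega>) = u2}"
  let ?D = "{\<omega> \<in> Om. step t ?q \<omega> = s}"
  have "{\<omega> \<in> Om. C t \<omega> = c \<and> Q t \<omega> = ?q \<and> (H (t + 1) \<omega>, Z (t + 1) \<omega>) = s} = ?A \<inter> ?B1 \<inter> ?B2 \<inter> ?D"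
  proof (intro Set.set_eqI iffI)
    fix \<omega> assume "\<omega> \<in> {\<omega> \<in> Om. C t \<omega> = c \<and> Q t \<omega> = ?q \<and> (H (t + 1) \<omega>, Z (t + 1) \<omega>) = s}"
    then show "\<omega> \<in> ?A \<inter> ?B1 \<inter> ?B2 \<inter> ?D"
      using step_Q[OF t, of \<omega>] act_eq[OF t, of \<omega>] by (auto simp: Q_def H_def)
  next
    fix \<omega> assume "\<omega> \<in> ?A \<inter> ?B1 \<inter> ?B2 \<inter> ?D"
    moreover from this have "Q t \<omega> = ?q" using act_eq[OF t, of \<omega>] by (auto simp: Q_def H_def)
    ultimately show "\<omega> \<in> {\<omega> \<in> Om. C t \<omega> = c \<and> Q t \<omega> = ?q \<and> (H (t + 1) \<omega>, Z (t + 1) \<omega>) = s}"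
      using step_Q[OF t, of \<omega>] by auto
  qed
  moreover have "?A \<in> sets (source_alg (past t))"
    using simple_function_event[OF simple_function_Pair[OF simple_C simple_H], of t
        "\<lambda>v. fst v = c \<and> snd v = (x, p1, p2)"] t by simp
  moreover have "?B1 \<in> sets (source_alg {Rand P1 t})" "?B2 \<in> sets (source_alg {Rand P2 t})"
    using simple_function_event[OF simple_kappa_rnd[OF t \<delta>(1)], of "{Rand P1 t}" "\<lambda>a. a = u1"]
      simple_function_event[OF simple_kappa_rnd[OF t \<delta>(2)], of "{Rand P2 t}" "\<lambda>a. a = u2"] by auto
  moreover have "?D \<in> sets (source_alg (fresh t))"
    using simple_function_event[OF simple_step[OF t], of "\<lambda>a. a = s" ?q] by simp
  ultimately show ?thesis
    using prob_past_rand_fresh[OF t, of ?A ?B1 ?B2 ?D] prob_kappa_rnd[OF t \<delta>(1) u(1)]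
      prob_kappa_rnd[OF t \<delta>(2) u(2)] by (simp add: step_prob_def)
qed

section \<open>Correctness of the common information belief\<close>

definition \<mu> :: "nat \<Rightarrow> ('y,'u) realiz \<Rightarrow> real" where
  "\<mu> t c = prob {\<omega> \<in> Om. C t \<omega> = c}"

definition belief_correct :: "nat \<Rightarrow> bool" where
  "belief_correct t \<longleftrightarrow> (\<forall>c\<in>realz G (com G t). \<forall>h\<in>hidden G t.
     prob {\<omega> \<in> Om. C t \<omega> = c \<and> H t \<omega> = h} = \<mu> t c * bel t c h)"

context
  fixes t c
  assumes t: "t \<in> {1..T}" and correct: "belief_correct t" and c: "c \<in> realz G (com G t)"
begin

lemma prob_C_Q_next:
  assumes q: "q \<in> situations t"
  shows "prob {\<omega> \<in> Om. C t \<omega> = c \<and> Q t \<omega> = q \<and> (H (t + 1) \<omega>, Z (t + 1) \<omega>) = s} =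
    \<mu> t c * (weight (bel t c) (pres P1 t c) (pres P2 t c) q * step_prob t q s)"
proof -
  obtain x p1 p2 u1 u2 where q': "q = ((x, p1, p2), u1, u2)" by (metis prod.exhaust)
  then have "(x, p1, p2) \<in> hidden G t" using q by (auto simp: situations_def)
  then have "prob {\<omega> \<in> Om. C t \<omega> = c \<and> H t \<omega> = (x, p1, p2)} = \<mu> t c * bel t c (x, p1, p2)"
    using correct c by (simp add: belief_correct_def)
  then show ?thesis using prob_step[OF t c q[unfolded q']] by (simp add: q' weight_def mult.assoc)
qed

lemma prob_C_Q:
  assumes q: "q \<in> situations t"
  shows "prob {\<omega> \<in> Om. C t \<omega> = c \<and> Q t \<omega> = q} =
    \<mu> t c * weight (bel t c) (pres P1 t c) (pres P2 t c) q"
proof -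
  let ?N = "hidden G (t + 1) \<times> realz G (inc G (t + 1))"
  have "prob {\<omega> \<in> Om. C t \<omega> = c \<and> Q t \<omega> = q} =
      (\<Sum>s\<in>?N. prob {\<omega> \<in> Om. (C t \<omega> = c \<and> Q t \<omega> = q) \<and> (H (t + 1) \<omega>, Z (t + 1) \<omega>) = s})"
  proof (rule prob_partition)
    show "simple_function (space_of G) (\<lambda>\<omega>. (H (t + 1) \<omega>, Z (t + 1) \<omega>))"
      using t by (intro simple_function_Pair simple_rv) auto
    show "{\<omega> \<in> Om. C t \<omega> = c \<and> Q t \<omega> = q} \<in> events"
      using simple_function_event[OF simple_function_Pair[OF simple_rv(1) simple_Q], of t t "\<lambda>v. fst v = c \<and> snd v = q"] t
      by simp
  qed (use finite_next[OF t] H_hidden[of "t + 1"] Z_realz[of "t + 1"] t in auto)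
  also have "\<dots> = (\<Sum>s\<in>?N. \<mu> t c * (weight (bel t c) (pres P1 t c) (pres P2 t c) q * step_prob t q s))"
    by (simp only: conj_assoc prob_C_Q_next[OF q])
  also have "\<dots> = \<mu> t c * (weight (bel t c) (pres P1 t c) (pres P2 t c) q * (\<Sum>s\<in>?N. step_prob t q s))"
    by (simp add: sum_distrib_left)
  finally show ?thesis by (simp only: sum_step_prob[OF t q] mult_1_right)
qed

text \<open>Summing over the current situation yields the numerator of Bayes' rule, scaled by the
  mass \<open>\<mu> t c\<close>.\<close>

lemma prob_C_Z_H:
  "prob {\<omega> \<in> Om. C t \<omega> = c \<and> Z (t + 1) \<omega> = z \<and> H (t + 1) \<omega> = (x', q1, q2)} =
    \<mu> t c * P_joint G t (bel t c) (pres P1 t c) (pres P2 t c) z x' q1 q2"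
proof -
  have "prob {\<omega> \<in> Om. C t \<omega> = c \<and> Z (t + 1) \<omega> = z \<and> H (t + 1) \<omega> = (x', q1, q2)} =
      (\<Sum>q\<in>situations t. prob {\<omega> \<in> Om. (C t \<omega> = c \<and> Z (t + 1) \<omega> = z \<and> H (t + 1) \<omega> = (x', q1, q2)) \<and> Q t \<omega> = q})"
  proof (rule prob_partition[OF simple_Q[OF t] finite_situations[OF t] Q_situations[OF t]])
    show "{\<omega> \<in> Om. C t \<omega> = c \<and> Z (t + 1) \<omega> = z \<and> H (t + 1) \<omega> = (x', q1, q2)} \<in> events"
      using simple_function_event[OF simple_function_Pair[OF simple_rv(1)[of t]
            simple_function_Pair[OF simple_rv(3)[of "t + 1"] simple_rv(2)[of "t + 1"]]],
          of "\<lambda>v. fst v = c \<and> fst (snd v) = z \<and> snd (snd v) = (x', q1, q2)"] t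
      by simp
  qed
  also have "\<dots> = (\<Sum>q\<in>situations t. prob {\<omega> \<in> Om. C t \<omega> = c \<and> Q t \<omega> = q \<and>
      (H (t + 1) \<omega>, Z (t + 1) \<omega>) = ((x', q1, q2), z)})"
    by (intro sum.cong refl arg_cong[where f = prob]) auto
  also have "\<dots> = (\<Sum>q\<in>situations t. \<mu> t c * (weight (bel t c) (pres P1 t c) (pres P2 t c) q *
      step_prob t q ((x', q1, q2), z)))"
    by (intro sum.cong refl prob_C_Q_next)
  finally show ?thesis by (simp add: P_joint_eq sum_distrib_left)
qed

lemma prob_C_Z:
  "prob {\<omega> \<in> Om. C t \<omega> = c \<and> Z (t + 1) \<omega> = z} =
    \<mu> t c * P_marg G t (bel t c) (pres P1 t c) (pres P2 t c) z"
proof -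
  have "prob {\<omega> \<in> Om. C t \<omega> = c \<and> Z (t + 1) \<omega> = z} =
      (\<Sum>h\<in>hidden G (t + 1). prob {\<omega> \<in> Om. (C t \<omega> = c \<and> Z (t + 1) \<omega> = z) \<and> H (t + 1) \<omega> = h})"
  proof (rule prob_partition)
    show "{\<omega> \<in> Om. C t \<omega> = c \<and> Z (t + 1) \<omega> = z} \<in> events"
      using simple_function_event[OF simple_function_Pair[OF simple_rv(1)[of t] simple_rv(3)[of "t + 1"]],
          of "\<lambda>v. fst v = c \<and> snd v = z"] t by simp
  qed (use t simple_rv(2)[of "t + 1"] finite_hidden[of "t + 1"] H_hidden[of "t + 1"] in auto)
  also have "\<dots> = (\<Sum>(x', q1, q2)\<in>hidden G (t + 1).
      \<mu> t c * P_joint G t (bel t c) (pres P1 t c) (pres P2 t c) z x' q1 q2)"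
    by (intro sum.cong refl) (clarsimp simp only: conj_assoc prob_C_Z_H split: prod.split)
  finally show ?thesis by (simp add: P_marg_def sum_distrib_left split_def)
qed

end

lemma belief_correct_1: "belief_correct 1"
  unfolding belief_correct_def
proof (intro ballI)
  fix c h assume "c \<in> realz G (com G 1)" "h \<in> hidden G 1"
  \<comment> \<open>By causality the dummy actions in \<open>realized_init\<close> and the actions
    of the play give the same values at time 1.\<close>
  have init: "realized_init G A \<omega> = realized G \<omega> (act \<omega>) A" if "A \<subseteq> avail 1" for A \<omega>
    unfolding realized_init_def using that by (intro realized_cong[of 1]) auto
  have 1: "realized_init G (com G 1) \<omega> = C 1 \<omega>" "realized_init G (priv G i 1) \<omega> = P i 1 \<omega>" for i \<omega>
    using com_avail[of 1] priv_avail[of 1 i] by (auto simp: init C_def P_def)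
  have b: "bel 1 c = prior G c"
    using \<open>c \<in> realz G (com G 1)\<close> by (simp add: bel_def realz_def)
  show "prob {\<omega> \<in> Om. C 1 \<omega> = c \<and> H 1 \<omega> = h} = \<mu> 1 c * bel 1 c h"
  proof (cases "\<mu> 1 c > 0")
    case True
    then show ?thesis
      unfolding b
      by (cases h) (simp add: prior_def 1[unfolded One_nat_def] \<mu>_def cond_prob_def H_def X_def conj_ac)
  next
    case False
    then have "\<mu> 1 c = 0" by (simp add: \<mu>_def zero_less_measure_iff)
    moreover have "prob {\<omega> \<in> Om. C 1 \<omega> = c \<and> H 1 \<omega> = h} \<le> \<mu> 1 c"
      unfolding \<mu>_def using simple_function_event[OF simple_rv(1)[of 1], of "\<lambda>v. v = c"]
      by (intro finite_measure_mono) auto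
    ultimately show ?thesis using measure_nonneg[of "space_of G"] by (simp add: order.antisym)
  qed
qed

text \<open>Bayes' rule: \<open>c'\<close> splits into its restriction to time \<open>t\<close> and
  its increment. The mass of \<open>c'\<close> is then a multiple of \<open>P_marg\<close>, the
  joint mass the same multiple of \<open>P_joint\<close>, and the quotient is
  \<open>update\<close>.\<close>

lemma belief_correct_Suc:
  assumes t: "t \<in> {1..T}" and correct: "belief_correct t"
  shows "belief_correct (t + 1)"
  unfolding belief_correct_def
proof (intro ballI)
  fix c' h assume c': "c' \<in> realz G (com G (t + 1))" and "h \<in> hidden G (t + 1)"
  obtain x' q1 q2 where h: "h = (x', q1, q2)" by (metis prod.exhaust)
  let ?c = "restrict c' (com G t)" and ?z = "restrict c' (inc G (t + 1))"
  have c: "?c \<in> realz G (com G t)" using restrict_realz[OF c' com_chain[of t "t + 1"]] t by auto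
  have CZ: "C (t + 1) \<omega> = c' \<longleftrightarrow> C t \<omega> = ?c \<and> Z (t + 1) \<omega> = ?z" if "\<omega> \<in> Om" for \<omega>
  proof
    assume "C (t + 1) \<omega> = c'"
    then show "C t \<omega> = ?c \<and> Z (t + 1) \<omega> = ?z"
      using restrict_C[of t "t + 1" \<omega>] restrict_C_inc[of t \<omega>] t by auto
  next
    assume *: "C t \<omega> = ?c \<and> Z (t + 1) \<omega> = ?z"
    show "C (t + 1) \<omega> = c'"
    \<comment> \<open>Every name in \<open>com G (t + 1)\<close> lies in \<open>com G t\<close> or
      in the increment, so the two restrictions determine the realization.\<close>
    proof (rule PiE_ext)
      show "C (t + 1) \<omega> \<in> Pi\<^sub>E (com G (t + 1)) (var_range G)" "c' \<in> Pi\<^sub>E (com G (t + 1)) (var_range G)"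
        using c' C_realz[of "t + 1" \<omega>] that t by (auto simp: realz_def)
      fix a assume a: "a \<in> com G (t + 1)"
      show "C (t + 1) \<omega> a = c' a"
        using a fun_cong[OF conjunct1[OF *], of a] fun_cong[OF conjunct2[OF *], of a]
        by (cases "a \<in> com G t") (auto simp: C_def Z_def realized_def inc_def restrict_apply)
    qed
  qed
  let ?m = "P_marg G t (bel t ?c) (pres P1 t ?c) (pres P2 t ?c) ?z"
  have "{\<omega> \<in> Om. C (t + 1) \<omega> = c'} = {\<omega> \<in> Om. C t \<omega> = ?c \<and> Z (t + 1) \<omega> = ?z}" using CZ by blast
  then have \<mu>: "\<mu> (t + 1) c' = \<mu> t ?c * ?m"
    using prob_C_Z[OF t correct c, of ?z] by (simp only: \<mu>_def)
  have "{\<omega> \<in> Om. C (t + 1) \<omega> = c' \<and> H (t + 1) \<omega> = h} =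
      {\<omega> \<in> Om. C t \<omega> = ?c \<and> Z (t + 1) \<omega> = ?z \<and> H (t + 1) \<omega> = (x', q1, q2)}" using CZ h by blast
  then have j: "prob {\<omega> \<in> Om. C (t + 1) \<omega> = c' \<and> H (t + 1) \<omega> = h} =
      \<mu> t ?c * P_joint G t (bel t ?c) (pres P1 t ?c) (pres P2 t ?c) ?z x' q1 q2"
    using prob_C_Z_H[OF t correct c, of ?z x' q1 q2] by (simp only:)
  have b: "bel (t + 1) c' = update G t (bel t ?c) (pres P1 t ?c) (pres P2 t ?c) ?z"
    using t bel_Suc[of t c'] by (simp add: bel_restrict pres_restrict)
  show "prob {\<omega> \<in> Om. C (t + 1) \<omega> = c' \<and> H (t + 1) \<omega> = h} = \<mu> (t + 1) c' * bel (t + 1) c' h"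
  proof (cases "?m > 0")
    case True
    then show ?thesis unfolding j \<mu> b by (simp add: update_def h)
  next
    case False
    \<comment> \<open>Now \<open>c'\<close> has mass zero, and the left side, being at most this
      mass, vanishes as well.\<close>
    then have "?m = 0"
      using P_marg_nonneg[OF t bel_beliefs[OF _ _ c] pres_prescrs[OF t c] pres_prescrs[OF t c], of ?z] t
      by simp
    then have "\<mu> (t + 1) c' = 0" by (simp only: \<mu> mult_zero_right)
    moreover have "prob {\<omega> \<in> Om. C (t + 1) \<omega> = c' \<and> H (t + 1) \<omega> = h} \<le> \<mu> (t + 1) c'"
      unfolding \<mu>_def using simple_function_event[OF simple_rv(1)[of "t + 1"], of "\<lambda>v. v = c'"] t
      by (intro finite_measure_mono) auto
    ultimately show ?thesis using measure_nonneg[of "space_of G"] by (simp add: order.antisym)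
  qed
qed

lemma belief_correct:
  assumes "1 \<le> t" "t \<le> T + 1"
  shows "belief_correct t"
  using assms
proof (induction t rule: dec_induct)
  case base
  show ?case by (rule belief_correct_1)
next
  case (step n)
  then show ?case using belief_correct_Suc[of n] by simp
qed

end


section \<open>The verification identity\<close>

context expanded_game
begin

text \<open>Crude, with a sum in place of a maximum, but uniform over beliefs and prescriptions
  because every situation has weight at most 1.\<close>

definition cost_bound :: "nat \<Rightarrow> real" where
  "cost_bound t = (\<Sum>q\<in>situations t. \<bar>situation_cost t q\<bar>)"

lemma abs_stage_cost_le:
  assumes "t \<in> {1..T}" "\<pi> \<in> beliefs G t" "\<gamma>1 \<in> prescrs G P1 t" "\<gamma>2 \<in> prescrs G P2 t"
  shows "\<bar>stage_cost G t \<pi> \<gamma>1 \<gamma>2\<bar> \<le> cost_bound t"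
proof -
  have w: "weight \<pi> \<gamma>1 \<gamma>2 q \<le> 1" if "q \<in> situations t" for q
    using member_le_sum[of q "situations t" "weight \<pi> \<gamma>1 \<gamma>2"] that finite_situations[OF assms(1)]
      weight_nonneg[OF assms(2-4)] sum_weight[OF assms] by simp
  have "\<bar>stage_cost G t \<pi> \<gamma>1 \<gamma>2\<bar> \<le> (\<Sum>q\<in>situations t. \<bar>situation_cost t q * weight \<pi> \<gamma>1 \<gamma>2 q\<bar>)"
    unfolding stage_cost_eq by (rule sum_abs)
  also have "\<dots> \<le> cost_bound t"
    unfolding cost_bound_def
    using w weight_nonneg[OF assms(2-4)] by (intro sum_mono) (simp add: abs_mult mult_left_le)
  finally show ?thesis .
qed

text \<open>The continuation term is an average over the probability vector \<open>P_marg\<close>,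
  so it inherits the bound on \<open>V\<close>.\<close>

lemma abs_q_value_le:
  assumes "t \<in> {1..T}" "\<pi> \<in> beliefs G t" "\<gamma>1 \<in> prescrs G P1 t" "\<gamma>2 \<in> prescrs G P2 t"
    and V: "\<And>\<pi>. \<pi> \<in> beliefs G (t + 1) \<Longrightarrow> \<bar>V \<pi>\<bar> \<le> B"
  shows "\<bar>q_value G t V \<pi> \<gamma>1 \<gamma>2\<bar> \<le> cost_bound t + B"
proof -
  let ?S = "\<Sum>z\<in>realz G (inc G (t + 1)). P_marg G t \<pi> \<gamma>1 \<gamma>2 z * V (update G t \<pi> \<gamma>1 \<gamma>2 z)"
  have "\<bar>?S\<bar> \<le> (\<Sum>z\<in>realz G (inc G (t + 1)). \<bar>P_marg G t \<pi> \<gamma>1 \<gamma>2 z * V (update G t \<pi> \<gamma>1 \<gamma>2 z)\<bar>)"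
    by (rule sum_abs)
  also have "\<dots> \<le> (\<Sum>z\<in>realz G (inc G (t + 1)). P_marg G t \<pi> \<gamma>1 \<gamma>2 z * B)"
    using V update_beliefs[OF assms(1-4)] P_marg_nonneg[OF assms(1-4)]
    by (intro sum_mono) (simp add: abs_mult mult_left_mono)
  also have "\<dots> = B" using sum_P_marg[OF assms(1-4)] by (simp flip: sum_distrib_right)
  finally show ?thesis using abs_stage_cost_le[OF assms(1-4)] unfolding q_value_def by linarith
qed

end

context played_game
begin

lemma game_cost_eq:
  "game_cost G (\<sigma> P1) (\<sigma> P2) = (\<Sum>t=1..T. expectation (\<lambda>\<omega>. situation_cost t (Q t \<omega>)))"
proof -
  have "game_cost G (\<sigma> P1) (\<sigma> P2) = expectation (\<lambda>\<omega>. \<Sum>t=1..T. situation_cost t (Q t \<omega>))"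
    by (simp add: game_cost_def situation_cost_def Q_def H_def X_def Let_def flip: act_def)
  also have "\<dots> = (\<Sum>t=1..T. expectation (\<lambda>\<omega>. situation_cost t (Q t \<omega>)))"
    by (intro Bochner_Integration.integral_sum integrable_simple simple_Q)
  finally show ?thesis .
qed

lemma abs_game_cost_le: "\<bar>game_cost G (\<sigma> P1) (\<sigma> P2)\<bar> \<le> (\<Sum>t=1..T. cost_bound t)"
proof -
  have "\<bar>expectation (\<lambda>\<omega>. situation_cost t (Q t \<omega>))\<bar> \<le> cost_bound t" if t: "t \<in> {1..T}" for t
  proof -
    have "\<bar>expectation (\<lambda>\<omega>. situation_cost t (Q t \<omega>))\<bar> \<le>
        (\<Sum>q\<in>situations t. \<bar>situation_cost t q * prob {\<omega> \<in> Om. Q t \<omega> = q}\<bar>)"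
      using expectation_simple[OF simple_Q[OF t] finite_situations[OF t] Q_situations[OF t],
          of "situation_cost t"] by (simp only: sum_abs)
    also have "\<dots> \<le> cost_bound t"
      unfolding cost_bound_def by (intro sum_mono) (simp add: abs_mult mult_left_le)
    finally show ?thesis .
  qed
  then show ?thesis
    unfolding game_cost_eq by (intro order.trans[OF sum_abs] sum_mono) auto
qed

lemma expectation_C:
  assumes "1 \<le> t" "t \<le> T + 1"
  shows "expectation (\<lambda>\<omega>. f (C t \<omega>)) = (\<Sum>c\<in>realz G (com G t). \<mu> t c * f c)"
  using expectation_simple[OF simple_rv(1)[OF assms] finite_com[OF assms] C_realz[OF assms], of f]
  by (simp add: \<mu>_def mult.commute)

lemma sum_\<mu>:
  assumes "1 \<le> t" "t \<le> T + 1"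
  shows "(\<Sum>c\<in>realz G (com G t). \<mu> t c) = 1"
  using expectation_C[OF assms, of "\<lambda>_. 1"] by (simp add: prob_space)

text \<open>Given \<open>C t = c\<close>, the situation has law \<open>weight\<close> and the
  increment has law \<open>P_marg\<close>, both at the belief \<open>bel t c\<close>; stage cost and
  continuation thus combine to \<open>q_value\<close>, for any \<open>V\<close>.\<close>

lemma expectation_stage:
  assumes t: "t \<in> {1..T}"
  shows "expectation (\<lambda>\<omega>. situation_cost t (Q t \<omega>)) + expectation (\<lambda>\<omega>. V (bel (t + 1) (C (t + 1) \<omega>))) =
    (\<Sum>c\<in>realz G (com G t). \<mu> t c * q_value G t V (bel t c) (pres P1 t c) (pres P2 t c))"
proof -
  have t': "1 \<le> t" "t \<le> T + 1" "1 \<le> t + 1" "t + 1 \<le> T + 1" using t by auto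
  note correct = belief_correct[OF t'(1,2)]
  have "expectation (\<lambda>\<omega>. situation_cost t (Q t \<omega>)) =
      (\<Sum>v\<in>realz G (com G t) \<times> situations t. situation_cost t (snd v) * prob {\<omega> \<in> Om. (C t \<omega>, Q t \<omega>) = v})"
    using expectation_simple[OF simple_function_Pair[OF simple_rv(1)[OF t'(1,2)] simple_Q[OF t]]
        finite_cartesian_product[OF finite_com[OF t'(1,2)] finite_situations[OF t]],
        of "\<lambda>v. situation_cost t (snd v)"] C_realz[OF t'(1,2)] Q_situations[OF t] by simp
  also have "\<dots> = (\<Sum>c\<in>realz G (com G t). \<Sum>q\<in>situations t.
      situation_cost t q * (\<mu> t c * weight (bel t c) (pres P1 t c) (pres P2 t c) q))"
    unfolding sum.cartesian_product
    using prob_C_Q[OF t correct] by (intro sum.cong) auto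
  also have "\<dots> = (\<Sum>c\<in>realz G (com G t). \<mu> t c * stage_cost G t (bel t c) (pres P1 t c) (pres P2 t c))"
    unfolding stage_cost_eq sum_distrib_left
    by (intro sum.cong refl) (simp add: mult_ac)
  finally have 1: "expectation (\<lambda>\<omega>. situation_cost t (Q t \<omega>)) = \<dots>" .
  \<comment> \<open>The next belief is a function of the current common information and the
    increment, a pair whose law is given by \<open>prob_C_Z\<close>.\<close>
  define F where "F v = (case v of (c, z) \<Rightarrow> V (update G t (bel t c) (pres P1 t c) (pres P2 t c) z))" for v
  have F: "V (bel (t + 1) (C (t + 1) \<omega>)) = F (C t \<omega>, Z (t + 1) \<omega>)" for \<omega>
  proof -
    have "bel t (C (t + 1) \<omega>) = bel t (C t \<omega>)"
      using bel_restrict[of t "t + 1" "C (t + 1) \<omega>"] bel_restrict[of t t "C (t + 1) \<omega>"]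
        restrict_C[of t "t + 1" \<omega>] t' by simp
    moreover have "pres i t (C (t + 1) \<omega>) = pres i t (C t \<omega>)" for i
      using pres_restrict[of t t i "C (t + 1) \<omega>"] restrict_C[of t "t + 1" \<omega>] t' by simp
    ultimately show ?thesis using bel_Suc[of t "C (t + 1) \<omega>"] t by (simp add: F_def restrict_C_inc[simplified])
  qed
  have "expectation (\<lambda>\<omega>. V (bel (t + 1) (C (t + 1) \<omega>))) =
      (\<Sum>v\<in>realz G (com G t) \<times> realz G (inc G (t + 1)). F v * prob {\<omega> \<in> Om. (C t \<omega>, Z (t + 1) \<omega>) = v})"
    unfolding F using C_realz[OF t'(1,2)] Z_realz[OF t'(3,4)]
    by (intro expectation_simple simple_function_Pair simple_rv finite_cartesian_product finite_com t'
        finite_realz[OF inc_avail]) (use t' in auto)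
  also have "\<dots> = (\<Sum>c\<in>realz G (com G t). \<Sum>z\<in>realz G (inc G (t + 1)).
      F (c, z) * (\<mu> t c * P_marg G t (bel t c) (pres P1 t c) (pres P2 t c) z))"
    unfolding sum.cartesian_product
    using prob_C_Z[OF t correct] by (intro sum.cong) auto
  finally have 2: "expectation (\<lambda>\<omega>. V (bel (t + 1) (C (t + 1) \<omega>))) = \<dots>" .
  show ?thesis
    unfolding 1 2 q_value_def distrib_left sum.distrib sum_distrib_left F_def
    by (simp add: mult_ac)
qed

text \<open>The cost differs from the value function at time 1 by the expected one-step defects of the
  dynamic programming equation along the play.\<close>

lemma game_cost_defect:
  assumes "W (T + 1) = (\<lambda>_. 0)"
  shows "game_cost G (\<sigma> P1) (\<sigma> P2) = expectation (\<lambda>\<omega>. W 1 (init_belief G \<omega>)) +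
    (\<Sum>t=1..T. \<Sum>c\<in>realz G (com G t). \<mu> t c *
      (q_value G t (W (t + 1)) (bel t c) (pres P1 t c) (pres P2 t c) - W t (bel t c)))"
proof -
  \<comment> \<open>\<open>D t\<close> is the expectation of \<open>W t\<close> at the belief along
    the play. The defects at \<open>t\<close> sum to the expected cost at \<open>t\<close> plus
    \<open>D (Suc t) - D t\<close>, and the differences telescope to \<open>- D 1\<close>.\<close>
  define D where "D t = expectation (\<lambda>\<omega>. W t (bel t (C t \<omega>)))" for t
  have d: "(\<Sum>c\<in>realz G (com G t). \<mu> t c *
      (q_value G t (W (t + 1)) (bel t c) (pres P1 t c) (pres P2 t c) - W t (bel t c))) =
      expectation (\<lambda>\<omega>. situation_cost t (Q t \<omega>)) + (D (Suc t) - D t)" if "t \<in> {1..T}" for t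
    using expectation_stage[OF that, of "W (t + 1)"] expectation_C[of t "\<lambda>c. W t (bel t c)"] that
    by (simp add: D_def right_diff_distrib sum_subtractf)
  have "D (Suc T) = 0" using assms by (simp add: D_def)
  then have "(\<Sum>t=1..T. expectation (\<lambda>\<omega>. situation_cost t (Q t \<omega>)) + (D (Suc t) - D t)) =
      game_cost G (\<sigma> P1) (\<sigma> P2) - D 1"
    using sum_Suc_diff[of 1 T D] by (simp add: sum.distrib game_cost_eq)
  moreover have "D 1 = expectation (\<lambda>\<omega>. W 1 (init_belief G \<omega>))"
    unfolding D_def
  proof (rule Bochner_Integration.integral_cong[OF refl])
    fix \<omega> assume "\<omega> \<in> Om"
    have "C 1 \<omega> = realized_init G (com G 1) \<omega>"
      unfolding realized_init_def C_def using com_avail[of 1] by (intro realized_cong[of 1]) auto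
    then show "W 1 (bel 1 (C 1 \<omega>)) = W 1 (init_belief G \<omega>)"
      using restrict_C[of 1 1 \<omega>] by (simp add: bel_def init_belief_def)
  qed
  ultimately show ?thesis using d by simp
qed

text \<open>At each time the masses \<open>\<mu> t\<close> add up to 1, so a stage contributes at
  most \<open>e\<close>, and there are \<open>T\<close> stages.\<close>

lemma sum_weighted_le:
  fixes e :: real
  assumes "\<And>t c. t \<in> {1..T} \<Longrightarrow> c \<in> realz G (com G t) \<Longrightarrow> f t c \<le> e"
  shows "(\<Sum>t=1..T. \<Sum>c\<in>realz G (com G t). \<mu> t c * f t c) \<le> T * e"
proof -
  have "(\<Sum>t=1..T. \<Sum>c\<in>realz G (com G t). \<mu> t c * f t c) \<le> (\<Sum>t=1..T. \<Sum>c\<in>realz G (com G t). \<mu> t c * e)"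
    using assms by (intro sum_mono mult_left_mono) (auto simp: \<mu>_def)
  also have "\<dots> = (\<Sum>t=1..T. e)"
    using sum_\<mu> by (intro sum.cong) (auto simp flip: sum_distrib_right)
  finally show ?thesis by simp
qed

lemma game_cost_le:
  fixes e :: real
  assumes "W (T + 1) = (\<lambda>_. 0)"
    and "\<And>t c. t \<in> {1..T} \<Longrightarrow> c \<in> realz G (com G t) \<Longrightarrow>
      q_value G t (W (t + 1)) (bel t c) (pres P1 t c) (pres P2 t c) \<le> W t (bel t c) + e"
  shows "game_cost G (\<sigma> P1) (\<sigma> P2) \<le> expectation (\<lambda>\<omega>. W 1 (init_belief G \<omega>)) + T * e"
  unfolding game_cost_defect[where W = W, OF assms(1)]
  using assms(2) by (intro add_left_mono sum_weighted_le) (simp add: algebra_simps)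

lemma game_cost_ge:
  fixes e :: real
  assumes "W (T + 1) = (\<lambda>_. 0)"
    and "\<And>t c. t \<in> {1..T} \<Longrightarrow> c \<in> realz G (com G t) \<Longrightarrow>
      W t (bel t c) - e \<le> q_value G t (W (t + 1)) (bel t c) (pres P1 t c) (pres P2 t c)"
  shows "expectation (\<lambda>\<omega>. W 1 (init_belief G \<omega>)) - T * e \<le> game_cost G (\<sigma> P1) (\<sigma> P2)"
proof -
  \<comment> \<open>The upper estimate applied to the negated defects.\<close>
  have "(\<Sum>t=1..T. \<Sum>c\<in>realz G (com G t). \<mu> t c *
      (W t (bel t c) - q_value G t (W (t + 1)) (bel t c) (pres P1 t c) (pres P2 t c))) \<le> T * e"
    by (rule sum_weighted_le) (use assms(2) in \<open>simp add: algebra_simps\<close>)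
  then show ?thesis
    unfolding game_cost_defect[where W = W, OF assms(1)] by (simp add: right_diff_distrib sum_subtractf)
qed

text \<open>Covers both kinds of strategy used below: responses, where \<open>R\<close> looks at the
  opponent's prescription, and belief-based strategies, where \<open>R\<close> ignores its third
  argument.\<close>

lemma pres_cib:
  assumes "t \<in> {1..T}" "\<sigma> i = (\<lambda>t c g. R t (cib G c g t) (\<sigma>' t c g))" "\<sigma>' = \<sigma> j"
  shows "pres i t c = R t (bel t c) (pres j t c)"
proof -
  have "cib G (restrict c (com G t)) (ghist G \<sigma> c (t - 1)) t = bel t c"
    unfolding bel_def using assms(1) restrict_com[of _ t c] by (intro cib_cong) auto
  then show ?thesis using assms(2,3) by (simp add: pres_def)
qed

end


section \<open>Optimal responses\<close>

context expanded_game
begin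

lemma played_gameI:
  assumes "\<sigma>1 \<in> strategies G P1" "\<sigma>2 \<in> strategies G P2"
  shows "played_game G (case_player \<sigma>1 \<sigma>2)"
  by unfold_locales (use assms in \<open>auto split: player.split\<close>)

lemma response_strategy:
  assumes "\<sigma> \<in> strategies G j"
    and "\<And>t \<pi> \<gamma>. t \<in> {1..T} \<Longrightarrow> \<pi> \<in> beliefs G t \<Longrightarrow> \<gamma> \<in> prescrs G j t \<Longrightarrow> R t \<pi> \<gamma> \<in> prescrs G i t"
  shows "(\<lambda>t c g. R t (cib G c g t) (\<sigma> t c g)) \<in> strategies G i"
  unfolding strategies_def
proof (clarify)
  fix t c g
  assume *: "t \<in> {1..T}" "c \<in> realz G (com G t)" "g \<in> (\<Pi>\<^sub>E s\<in>{1..<t}. prescrs G P1 s \<times> prescrs G P2 s)"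
  have "g s \<in> prescrs G P1 s \<times> prescrs G P2 s" if "s \<in> {1..<t}" for s using PiE_mem[OF *(3) that] .
  then have "cib G c g t \<in> beliefs G t" using * by (intro cib_beliefs) (auto simp: mem_Times_iff)
  then show "R t (cib G c g t) (\<sigma> t c g) \<in> prescrs G i t"
    using * assms(1) by (intro assms(2)) (auto simp: strategies_def)
qed

lemma strategies_nonempty: "strategies G i \<noteq> {}"
proof -
  have "(\<lambda>t c g. SOME \<gamma>. \<gamma> \<in> prescrs G i t) \<in> strategies G i"
    using prescrs_nonempty by (auto simp: strategies_def some_in_eq)
  then show ?thesis by auto
qed

lemma belief_strategy:
  assumes "\<And>t \<pi>. t \<in> {1..T} \<Longrightarrow> \<pi> \<in> beliefs G t \<Longrightarrow> \<Xi> t \<pi> \<in> prescrs G i t"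
  shows "belief_strategy G \<Xi> \<in> strategies G i"
proof -
  \<comment> \<open>A placeholder to respond to: the response in question does not look at
    it.\<close>
  obtain \<sigma> where "\<sigma> \<in> strategies G P1" using strategies_nonempty by auto
  from response_strategy[OF this, of "\<lambda>t \<pi> _. \<Xi> t \<pi>" i] assms show ?thesis
    by (simp add: belief_strategy_def)
qed

text \<open>Both players see the same common information and prescription history, so for fixed
  \<open>\<sigma>1\<close> the prescription it is about to select is computable from the maximizer's
  own data. Answering it is therefore an ordinary strategy.\<close>

lemma response2_ge:
  fixes e :: real
  assumes \<sigma>1: "\<sigma>1 \<in> strategies G P1" and W: "W (T + 1) = (\<lambda>_. 0)"
    and R: "\<And>t \<pi> \<gamma>1. t \<in> {1..T} \<Longrightarrow> \<pi> \<in> beliefs G t \<Longrightarrow> \<gamma>1 \<in> prescrs G P1 t \<Longrightarrow>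
      R t \<pi> \<gamma>1 \<in> prescrs G P2 t \<and> W t \<pi> - e \<le> q_value G t (W (t + 1)) \<pi> \<gamma>1 (R t \<pi> \<gamma>1)"
  shows "\<exists>\<sigma>2\<in>strategies G P2.
    expectation (\<lambda>\<omega>. W 1 (init_belief G \<omega>)) - T * e \<le> game_cost G \<sigma>1 \<sigma>2"
proof
  let ?\<sigma>2 = "\<lambda>t c g. R t (cib G c g t) (\<sigma>1 t c g)"
  show \<sigma>2: "?\<sigma>2 \<in> strategies G P2" using R by (intro response_strategy[OF \<sigma>1]) auto
  interpret played_game G "case_player \<sigma>1 ?\<sigma>2" by (rule played_gameI[OF \<sigma>1 \<sigma>2])
  show "expectation (\<lambda>\<omega>. W 1 (init_belief G \<omega>)) - T * e \<le> game_cost G \<sigma>1 ?\<sigma>2"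
    using game_cost_ge[where W = W and e = e, OF W] R bel_beliefs pres_prescrs pres_cib[of _ P2 R \<sigma>1 P1] by simp
qed

lemma response1_le:
  fixes e :: real
  assumes \<sigma>2: "\<sigma>2 \<in> strategies G P2" and W: "W (T + 1) = (\<lambda>_. 0)"
    and R: "\<And>t \<pi> \<gamma>2. t \<in> {1..T} \<Longrightarrow> \<pi> \<in> beliefs G t \<Longrightarrow> \<gamma>2 \<in> prescrs G P2 t \<Longrightarrow>
      R t \<pi> \<gamma>2 \<in> prescrs G P1 t \<and> q_value G t (W (t + 1)) \<pi> (R t \<pi> \<gamma>2) \<gamma>2 \<le> W t \<pi> + e"
  shows "\<exists>\<sigma>1\<in>strategies G P1.
    game_cost G \<sigma>1 \<sigma>2 \<le> expectation (\<lambda>\<omega>. W 1 (init_belief G \<omega>)) + T * e"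
proof
  let ?\<sigma>1 = "\<lambda>t c g. R t (cib G c g t) (\<sigma>2 t c g)"
  show \<sigma>1: "?\<sigma>1 \<in> strategies G P1" using R by (intro response_strategy[OF \<sigma>2]) auto
  interpret played_game G "case_player ?\<sigma>1 \<sigma>2" by (rule played_gameI[OF \<sigma>1 \<sigma>2])
  show "game_cost G ?\<sigma>1 \<sigma>2 \<le> expectation (\<lambda>\<omega>. W 1 (init_belief G \<omega>)) + T * e"
    using game_cost_le[where W = W and e = e, OF W] R bel_beliefs pres_prescrs pres_cib[of _ P1 R \<sigma>2 P2] by simp
qed

lemma belief_strategy1_le:
  fixes e :: real
  assumes \<sigma>2: "\<sigma>2 \<in> strategies G P2" and W: "W (T + 1) = (\<lambda>_. 0)"
    and \<Xi>: "\<And>t \<pi>. t \<in> {1..T} \<Longrightarrow> \<pi> \<in> beliefs G t \<Longrightarrow> \<Xi> t \<pi> \<in> prescrs G P1 t \<and>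
      (\<forall>\<gamma>2\<in>prescrs G P2 t. q_value G t (W (t + 1)) \<pi> (\<Xi> t \<pi>) \<gamma>2 \<le> W t \<pi> + e)"
  shows "game_cost G (belief_strategy G \<Xi>) \<sigma>2 \<le> expectation (\<lambda>\<omega>. W 1 (init_belief G \<omega>)) + T * e"
proof -
  have \<sigma>1: "belief_strategy G \<Xi> \<in> strategies G P1" using \<Xi> by (intro belief_strategy) auto
  interpret played_game G "case_player (belief_strategy G \<Xi>) \<sigma>2" by (rule played_gameI[OF \<sigma>1 \<sigma>2])
  show ?thesis
    using game_cost_le[where W = W and e = e, OF W] \<Xi> bel_beliefs pres_prescrs
      pres_cib[of _ P1 "\<lambda>t \<pi> _. \<Xi> t \<pi>" \<sigma>2 P2] by (simp add: belief_strategy_def)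
qed

lemma belief_strategy2_ge:
  fixes e :: real
  assumes \<sigma>1: "\<sigma>1 \<in> strategies G P1" and W: "W (T + 1) = (\<lambda>_. 0)"
    and \<Xi>: "\<And>t \<pi>. t \<in> {1..T} \<Longrightarrow> \<pi> \<in> beliefs G t \<Longrightarrow> \<Xi> t \<pi> \<in> prescrs G P2 t \<and>
      (\<forall>\<gamma>1\<in>prescrs G P1 t. W t \<pi> - e \<le> q_value G t (W (t + 1)) \<pi> \<gamma>1 (\<Xi> t \<pi>))"
  shows "expectation (\<lambda>\<omega>. W 1 (init_belief G \<omega>)) - T * e \<le> game_cost G \<sigma>1 (belief_strategy G \<Xi>)"
proof -
  have \<sigma>2: "belief_strategy G \<Xi> \<in> strategies G P2" using \<Xi> by (intro belief_strategy) auto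
  interpret played_game G "case_player \<sigma>1 (belief_strategy G \<Xi>)" by (rule played_gameI[OF \<sigma>1 \<sigma>2])
  show ?thesis
    using game_cost_ge[where W = W and e = e, OF W] \<Xi> bel_beliefs pres_prescrs
      pres_cib[of _ P2 "\<lambda>t \<pi> _. \<Xi> t \<pi>" \<sigma>1 P1] by (simp add: belief_strategy_def)
qed

section \<open>Boundedness of the game and of its stage games\<close>

lemma bounded_payoff_game_cost:
  "bounded_payoff (strategies G P1) (strategies G P2) (game_cost G) (\<Sum>t=1..T. cost_bound t)"
proof
  fix \<sigma>1 \<sigma>2 assume "\<sigma>1 \<in> strategies G P1" "\<sigma>2 \<in> strategies G P2"
  then interpret played_game G "case_player \<sigma>1 \<sigma>2" by (rule played_gameI)
  show "\<bar>game_cost G \<sigma>1 \<sigma>2\<bar> \<le> (\<Sum>t=1..T. cost_bound t)" using abs_game_cost_le by simp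
qed (rule strategies_nonempty)+

lemma bounded_payoff_q_value:
  assumes "t \<in> {1..T}" "\<pi> \<in> beliefs G t" "\<And>\<pi>. \<pi> \<in> beliefs G (t + 1) \<Longrightarrow> \<bar>V \<pi>\<bar> \<le> B"
  shows "bounded_payoff (prescrs G P1 t) (prescrs G P2 t) (q_value G t V \<pi>) (cost_bound t + B)"
  by unfold_locales (use assms prescrs_nonempty[OF assms(1)] abs_q_value_le in auto)

text \<open>Backward induction from the horizon: each stage adds \<open>cost_bound t\<close> to a
  bound that is uniform over beliefs.\<close>

lemma V_upper_bounded: "t \<le> T + 1 \<Longrightarrow> 1 \<le> t \<Longrightarrow> \<exists>B. \<forall>\<pi>\<in>beliefs G t. \<bar>V_upper G t \<pi>\<bar> \<le> B"
proof (induction t rule: inc_induct)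
  case base
  show ?case by (rule exI[of _ 0]) (simp add: V_upper.simps)
next
  case (step t)
  then obtain B where B: "\<And>\<pi>. \<pi> \<in> beliefs G (t + 1) \<Longrightarrow> \<bar>V_upper G (t + 1) \<pi>\<bar> \<le> B" by auto
  have t: "t \<in> {1..T}" using step by auto
  have "\<bar>V_upper G t \<pi>\<bar> \<le> cost_bound t + B" if \<pi>: "\<pi> \<in> beliefs G t" for \<pi>
    using t abs_q_value_le[OF t \<pi> _ _ B] unfolding V_upper.simps[of G t]
    by (auto intro!: abs_INF_le abs_SUP_le prescrs_nonempty)
  then show ?case by blast
qed

lemma V_lower_bounded: "t \<le> T + 1 \<Longrightarrow> 1 \<le> t \<Longrightarrow> \<exists>B. \<forall>\<pi>\<in>beliefs G t. \<bar>V_lower G t \<pi>\<bar> \<le> B"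
proof (induction t rule: inc_induct)
  case base
  show ?case by (rule exI[of _ 0]) (simp add: V_lower.simps)
next
  case (step t)
  then obtain B where B: "\<And>\<pi>. \<pi> \<in> beliefs G (t + 1) \<Longrightarrow> \<bar>V_lower G (t + 1) \<pi>\<bar> \<le> B" by auto
  have t: "t \<in> {1..T}" using step by auto
  have "\<bar>V_lower G t \<pi>\<bar> \<le> cost_bound t + B" if \<pi>: "\<pi> \<in> beliefs G t" for \<pi>
    using t abs_q_value_le[OF t \<pi> _ _ B] unfolding V_lower.simps[of G t]
    by (auto intro!: abs_INF_le abs_SUP_le prescrs_nonempty)
  then show ?case by blast
qed

lemma V_upper_game:
  assumes t: "t \<in> {1..T}" and \<pi>: "\<pi> \<in> beliefs G t"
  obtains B where "bounded_payoff (prescrs G P1 t) (prescrs G P2 t) (q_value G t (V_upper G (t + 1)) \<pi>) B"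
    "V_upper G t \<pi> = (INF \<gamma>1\<in>prescrs G P1 t. SUP \<gamma>2\<in>prescrs G P2 t. q_value G t (V_upper G (t + 1)) \<pi> \<gamma>1 \<gamma>2)"
proof -
  obtain B where "\<forall>\<pi>\<in>beliefs G (t + 1). \<bar>V_upper G (t + 1) \<pi>\<bar> \<le> B"
    using V_upper_bounded[of "t + 1"] t by auto
  then show thesis
    using t by (intro that[OF bounded_payoff_q_value[OF t \<pi>]]) (auto simp: V_upper.simps[of G t])
qed

lemma V_lower_game:
  assumes t: "t \<in> {1..T}" and \<pi>: "\<pi> \<in> beliefs G t"
  obtains B where "bounded_payoff (prescrs G P1 t) (prescrs G P2 t) (q_value G t (V_lower G (t + 1)) \<pi>) B"
    "V_lower G t \<pi> = (SUP \<gamma>2\<in>prescrs G P2 t. INF \<gamma>1\<in>prescrs G P1 t. q_value G t (V_lower G (t + 1)) \<pi> \<gamma>1 \<gamma>2)"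
proof -
  obtain B where "\<forall>\<pi>\<in>beliefs G (t + 1). \<bar>V_lower G (t + 1) \<pi>\<bar> \<le> B"
    using V_lower_bounded[of "t + 1"] t by auto
  then show thesis
    using t by (intro that[OF bounded_payoff_q_value[OF t \<pi>]]) (auto simp: V_lower.simps[of G t])
qed

lemma upper_value_eq: "upper_value G = expectation (\<lambda>\<omega>. V_upper G 1 (init_belief G \<omega>))"
  unfolding upper_value_def
proof (rule bounded_payoff.INF_SUP_eqI[OF bounded_payoff_game_cost])
  fix e :: real assume e: "0 < e"
  \<comment> \<open>The error is shared equally among the \<open>T\<close> stages, so the
    accumulated loss is at most \<open>e\<close>.\<close>
  define d where "d = e / T"
  have d: "0 < d" "T * d = e" using e horizon_pos by (auto simp: d_def)
  have W: "V_upper G (T + 1) = (\<lambda>_. 0)" by (simp add: V_upper.simps)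
  {
    \<comment> \<open>The premises sit inside the existential so that one total function
      \<open>\<Xi>\<close> can be chosen for all times and beliefs.\<close>
    have "\<exists>\<gamma>1. t \<in> {1..T} \<longrightarrow> \<pi> \<in> beliefs G t \<longrightarrow> \<gamma>1 \<in> prescrs G P1 t \<and>
        (\<forall>\<gamma>2\<in>prescrs G P2 t. q_value G t (V_upper G (t + 1)) \<pi> \<gamma>1 \<gamma>2 \<le> V_upper G t \<pi> + d)" for t \<pi>
      using V_upper_game[of t \<pi>] bounded_payoff.INF_SUP_near[OF _ d(1)] by metis
    then obtain \<Xi> where \<Xi>: "\<And>t \<pi>. t \<in> {1..T} \<Longrightarrow> \<pi> \<in> beliefs G t \<Longrightarrow> \<Xi> t \<pi> \<in> prescrs G P1 t \<and>
        (\<forall>\<gamma>2\<in>prescrs G P2 t. q_value G t (V_upper G (t + 1)) \<pi> (\<Xi> t \<pi>) \<gamma>2 \<le> V_upper G t \<pi> + d)"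
      by metis
    show "\<exists>\<sigma>1\<in>strategies G P1. \<forall>\<sigma>2\<in>strategies G P2.
        game_cost G \<sigma>1 \<sigma>2 \<le> expectation (\<lambda>\<omega>. V_upper G 1 (init_belief G \<omega>)) + e"
      using belief_strategy[of \<Xi> P1] \<Xi> belief_strategy1_le[where W = "V_upper G", OF _ W \<Xi>]
      by (intro bexI[of _ "belief_strategy G \<Xi>"]) (auto simp: d)
  next
    fix \<sigma>1 assume \<sigma>1: "\<sigma>1 \<in> strategies G P1"
    \<comment> \<open>Here the choice depends on \<open>\<gamma>1\<close> too: it is the maximizer's
      answer to the prescription in use.\<close>
    have "\<exists>\<gamma>2. t \<in> {1..T} \<longrightarrow> \<pi> \<in> beliefs G t \<longrightarrow> \<gamma>1 \<in> prescrs G P1 t \<longrightarrow> \<gamma>2 \<in> prescrs G P2 t \<and>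
        V_upper G t \<pi> - d \<le> q_value G t (V_upper G (t + 1)) \<pi> \<gamma>1 \<gamma>2" for t \<pi> \<gamma>1
      using V_upper_game[of t \<pi>] bounded_payoff.SUP_response[OF _ d(1)] by metis
    then obtain R where R: "\<And>t \<pi> \<gamma>1. t \<in> {1..T} \<Longrightarrow> \<pi> \<in> beliefs G t \<Longrightarrow> \<gamma>1 \<in> prescrs G P1 t \<Longrightarrow>
        R t \<pi> \<gamma>1 \<in> prescrs G P2 t \<and>
        V_upper G t \<pi> - d \<le> q_value G t (V_upper G (t + 1)) \<pi> \<gamma>1 (R t \<pi> \<gamma>1)"
      by metis
    show "\<exists>\<sigma>2\<in>strategies G P2.
        expectation (\<lambda>\<omega>. V_upper G 1 (init_belief G \<omega>)) - e \<le> game_cost G \<sigma>1 \<sigma>2"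
      using response2_ge[where W = "V_upper G", OF \<sigma>1 W R] by (simp add: d)
  }
qed

lemma lower_value_eq: "lower_value G = expectation (\<lambda>\<omega>. V_lower G 1 (init_belief G \<omega>))"
  unfolding lower_value_def
proof (rule bounded_payoff.SUP_INF_eqI[OF bounded_payoff_game_cost])
  fix e :: real assume e: "0 < e"
  define d where "d = e / T"
  have d: "0 < d" "T * d = e" using e horizon_pos by (auto simp: d_def)
  have W: "V_lower G (T + 1) = (\<lambda>_. 0)" by (simp add: V_lower.simps)
  {
    have "\<exists>\<gamma>2. t \<in> {1..T} \<longrightarrow> \<pi> \<in> beliefs G t \<longrightarrow> \<gamma>2 \<in> prescrs G P2 t \<and>
        (\<forall>\<gamma>1\<in>prescrs G P1 t. V_lower G t \<pi> - d \<le> q_value G t (V_lower G (t + 1)) \<pi> \<gamma>1 \<gamma>2)" for t \<pi>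
      using V_lower_game[of t \<pi>] bounded_payoff.SUP_INF_near[OF _ d(1)] by metis
    then obtain \<Xi> where \<Xi>: "\<And>t \<pi>. t \<in> {1..T} \<Longrightarrow> \<pi> \<in> beliefs G t \<Longrightarrow> \<Xi> t \<pi> \<in> prescrs G P2 t \<and>
        (\<forall>\<gamma>1\<in>prescrs G P1 t. V_lower G t \<pi> - d \<le> q_value G t (V_lower G (t + 1)) \<pi> \<gamma>1 (\<Xi> t \<pi>))"
      by metis
    show "\<exists>\<sigma>2\<in>strategies G P2. \<forall>\<sigma>1\<in>strategies G P1.
        expectation (\<lambda>\<omega>. V_lower G 1 (init_belief G \<omega>)) - e \<le> game_cost G \<sigma>1 \<sigma>2"
      using belief_strategy[of \<Xi> P2] \<Xi> belief_strategy2_ge[where W = "V_lower G", OF _ W \<Xi>]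
      by (intro bexI[of _ "belief_strategy G \<Xi>"]) (auto simp: d)
  next
    fix \<sigma>2 assume \<sigma>2: "\<sigma>2 \<in> strategies G P2"
    have "\<exists>\<gamma>1. t \<in> {1..T} \<longrightarrow> \<pi> \<in> beliefs G t \<longrightarrow> \<gamma>2 \<in> prescrs G P2 t \<longrightarrow> \<gamma>1 \<in> prescrs G P1 t \<and>
        q_value G t (V_lower G (t + 1)) \<pi> \<gamma>1 \<gamma>2 \<le> V_lower G t \<pi> + d" for t \<pi> \<gamma>2
      using V_lower_game[of t \<pi>] bounded_payoff.INF_response[OF _ d(1)] by metis
    then obtain R where R: "\<And>t \<pi> \<gamma>2. t \<in> {1..T} \<Longrightarrow> \<pi> \<in> beliefs G t \<Longrightarrow> \<gamma>2 \<in> prescrs G P2 t \<Longrightarrow>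
        R t \<pi> \<gamma>2 \<in> prescrs G P1 t \<and>
        q_value G t (V_lower G (t + 1)) \<pi> (R t \<pi> \<gamma>2) \<gamma>2 \<le> V_lower G t \<pi> + d"
      by metis
    show "\<exists>\<sigma>1\<in>strategies G P1.
        game_cost G \<sigma>1 \<sigma>2 \<le> expectation (\<lambda>\<omega>. V_lower G 1 (init_belief G \<omega>)) + e"
      using response1_le[where W = "V_lower G", OF \<sigma>2 W R] by (simp add: d)
  }
qed

section \<open>Optimality of the belief-based strategies given by exact selectors\<close>

lemma selector_prescrs:
  assumes "\<Xi> t \<in> measurable (belief_space G t) (prescr_space G i t)" "\<pi> \<in> beliefs G t"
  shows "\<Xi> t \<pi> \<in> prescrs G i t"
  using measurable_space[OF assms(1), of \<pi>] assms(2)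
  by (simp add: belief_space_def prescr_space_def space_restrict_space)

text \<open>An exact selector has no positive defect, so no error accumulates and its worst-case
  cost is at most the value; the reverse inequality is the definition of the infimum.\<close>

lemma minmax_selector_strategy:
  assumes "minmax_selector G \<Xi>"
  shows "minmax_strategy G (belief_strategy G \<Xi>)"
proof -
  interpret bounded_payoff "strategies G P1" "strategies G P2" "game_cost G" "\<Sum>t=1..T. cost_bound t"
    by (rule bounded_payoff_game_cost)
  \<comment> \<open>The summand 0 casts the exact bound in the form with an error term, taken with
    \<open>e = 0\<close>.\<close>
  have \<Xi>: "\<Xi> t \<pi> \<in> prescrs G P1 t \<and>
      (\<forall>\<gamma>2\<in>prescrs G P2 t. q_value G t (V_upper G (t + 1)) \<pi> (\<Xi> t \<pi>) \<gamma>2 \<le> V_upper G t \<pi> + 0)"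
    if "t \<in> {1..T}" "\<pi> \<in> beliefs G t" for t \<pi>
    using assms that selector_prescrs[of \<Xi> t P1 \<pi>] by (simp add: minmax_selector_def w_upper_def)
  have s: "belief_strategy G \<Xi> \<in> strategies G P1" using \<Xi> by (intro belief_strategy) auto
  have "(SUP \<sigma>2\<in>strategies G P2. game_cost G (belief_strategy G \<Xi>) \<sigma>2) \<le> upper_value G"
    unfolding upper_value_eq
    using belief_strategy1_le[where W = "V_upper G", OF _ _ \<Xi>] nonempty
    by (intro cSUP_least) (auto simp: V_upper.simps[of G "Suc T"])
  moreover have "upper_value G \<le> (SUP \<sigma>2\<in>strategies G P2. game_cost G (belief_strategy G \<Xi>) \<sigma>2)"
    unfolding upper_value_def using s by (rule cINF_lower[OF bdd_below_SUP])
  ultimately show ?thesis using s by (simp add: minmax_strategy_def)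
qed

text \<open>The selector keeps every defect nonnegative, so the cost is at least the value against
  each minimizer; the supremum gives the converse.\<close>

lemma maxmin_selector_strategy:
  assumes "maxmin_selector G \<Xi>"
  shows "maxmin_strategy G (belief_strategy G \<Xi>)"
proof -
  interpret bounded_payoff "strategies G P1" "strategies G P2" "game_cost G" "\<Sum>t=1..T. cost_bound t"
    by (rule bounded_payoff_game_cost)
  have \<Xi>: "\<Xi> t \<pi> \<in> prescrs G P2 t \<and>
      (\<forall>\<gamma>1\<in>prescrs G P1 t. V_lower G t \<pi> - 0 \<le> q_value G t (V_lower G (t + 1)) \<pi> \<gamma>1 (\<Xi> t \<pi>))"
    if "t \<in> {1..T}" "\<pi> \<in> beliefs G t" for t \<pi>
    using assms that selector_prescrs[of \<Xi> t P2 \<pi>] by (simp add: maxmin_selector_def w_lower_def)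
  have s: "belief_strategy G \<Xi> \<in> strategies G P2" using \<Xi> by (intro belief_strategy) auto
  have "lower_value G \<le> (INF \<sigma>1\<in>strategies G P1. game_cost G \<sigma>1 (belief_strategy G \<Xi>))"
    unfolding lower_value_eq
    using belief_strategy2_ge[where W = "V_lower G", OF _ _ \<Xi>] nonempty
    by (intro cINF_greatest) (auto simp: V_lower.simps[of G "Suc T"])
  moreover have "(INF \<sigma>1\<in>strategies G P1. game_cost G \<sigma>1 (belief_strategy G \<Xi>)) \<le> lower_value G"
    unfolding lower_value_def using s by (rule cSUP_upper[OF _ bdd_above_INF])
  ultimately show ?thesis using s by (simp add: maxmin_strategy_def)
qed

end

theorem theorem2:
  fixes G :: "('m,'x,'u,'y,'w) game"
  assumes "expanded_game G"
  shows "upper_value G = (\<integral>\<omega>. V_upper G 1 (init_belief G \<omega>) \<partial>(space_of G))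
       \<and> lower_value G = (\<integral>\<omega>. V_lower G 1 (init_belief G \<omega>) \<partial>(space_of G))
       \<and> (\<forall>\<Xi>1. minmax_selector G \<Xi>1 \<longrightarrow> minmax_strategy G (belief_strategy G \<Xi>1))
       \<and> (\<forall>\<Xi>2. maxmin_selector G \<Xi>2 \<longrightarrow> maxmin_strategy G (belief_strategy G \<Xi>2))"
proof -
  interpret expanded_game G by (rule assms)
  show ?thesis
    using upper_value_eq lower_value_eq minmax_selector_strategy maxmin_selector_strategy by blast
qed

end
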